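(* Let $p$ be a prime, let $q$ and $n$ be positive integers, let $T(p,q)$ be the torus link and $R_n$ the dihedral quandle of order $n$. If $n$ is even and $|\operatorname{Hom}(Q(T(p,q)),R_n)|=2^{p-1}n$, then the full quandle coloring quiver of $T(p,q)$ with respect to $R_n$ is (isomorphic to) the directed graph $$\mathcal{Q}_{R_n}(T(p,q))=(\overleftrightarrow{K_n},\hat n)\,\overleftarrow{\nabla}_{\hat d}\,\Big[\bigsqcup_{2^{p-1}-1}\left(\overleftrightarrow{K_n},\hat d\right)\Big],\qquad d=\frac{n}{2}.$$
   Context: A quandle is a set $X$ with a binary operation $*$ such that $(x*y)*z=(x*z)*(y*z)$ for all $x,y,z$; for each $x$ the map $R_x:X\to X$, $y\mapsto y*x$, is a bijection; and $x*x=x$ for all $x$. Write $x\bar{*}y=R_y^{-1}(x)$. The dihedral quandle $R_n$ is $\mathbb{Z}_n=\mathbb{Z}/n\mathbb{Z}$ with $x*y=2y-x \pmod n$. A quandle homomorphism is a map preserving $*$. For an oriented link $K$ with diagram $D$, the fundamental quandle $Q(K)$ is the quandle generated by the arcs of $D$ with one relation per crossing: if $y$ is the over-arc and $x,z$ are the incoming and outgoing under-arcs, then $z=x*y$ at a positive crossing and $z=x\bar{*}y$ at a negative crossing. $\operatorname{Hom}(Q(K),X)$ is the set of quandle homomorphisms $Q(K)\to X$; it is identified with the set of colorings of $D$ by $X$, i.e. maps from arcs to $X$ satisfying the crossing relations. The torus link $T(p,q)$ is the closure of the $p$-strand braid $(\sigma_1\sigma_2\cdots\sigma_{p-1})^q$.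 The full quandle coloring quiver $\mathcal{Q}_X(K)$ of $K$ with respect to a finite quandle $X$ is the directed multigraph with vertex set $\operatorname{Hom}(Q(K),X)$ and, for each vertex $f$ and each quandle endomorphism $\phi:X\to X$, one directed edge from $f$ to $\phi\circ f$. Notation: $(\overleftrightarrow{K_m},\hat\omega)$ is the directed multigraph on $m$ vertices with exactly $\omega$ directed edges from each vertex to each vertex (including from each vertex to itself). $\bigsqcup_{m}G$ is the disjoint union of $m$ copies of $G$ (no edges between different copies). For directed multigraphs $G_1,G_2$ with disjoint vertex and edge sets, $G_1\overleftarrow{\nabla}_{\hat d}G_2$ is the union of $G_1$ and $G_2$ together with exactly $d$ directed edges from each vertex of $G_2$ to each vertex of $G_1$ (and no edges from $G_1$ to $G_2$). Equality of directed multigraphs means isomorphism. *)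

theory Defs
  imports
    "HOL-Computational_Algebra.Primes"
    "HOL-Library.FuncSet"
    "Graph_Theory.Digraph_Isomorphism"
begin

section \<open>Quandles\<close>

record 'a quandle =
  qcarrier :: "'a set"
  qop :: "'a \<Rightarrow> 'a \<Rightarrow> 'a"

definition is_quandle :: "'a quandle \<Rightarrow> bool" where
  "is_quandle X \<longleftrightarrow>
     (\<forall>x\<in>qcarrier X. \<forall>y\<in>qcarrier X. qop X x y \<in> qcarrier X) \<and>
     (\<forall>x\<in>qcarrier X. \<forall>y\<in>qcarrier X. \<forall>z\<in>qcarrier X.
        qop X (qop X x y) z = qop X (qop X x z) (qop X y z)) \<and>
     (\<forall>x\<in>qcarrier X. bij_betw (\<lambda>y. qop X y x) (qcarrier X) (qcarrier X)) \<and>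
     (\<forall>x\<in>qcarrier X. qop X x x = x)"

text \<open>Homomorphisms are extensional (\<open>undefined\<close> off the carrier), so that they form a set with one
  element per map of carriers.\<close>

definition quandle_hom :: "'a quandle \<Rightarrow> 'b quandle \<Rightarrow> ('a \<Rightarrow> 'b) set" where
  "quandle_hom X Y = {f \<in> qcarrier X \<rightarrow>\<^sub>E qcarrier Y.
     \<forall>x\<in>qcarrier X. \<forall>y\<in>qcarrier X. f (qop X x y) = qop Y (f x) (f y)}"

definition dihedral_quandle :: "nat \<Rightarrow> int quandle" where
  "dihedral_quandle n =
     \<lparr>qcarrier = {0..<int n}, qop = (\<lambda>x y. (2 * y - x) mod int n)\<rparr>"

lemma is_quandle_dihedral:
  assumes "n > 0"
  shows "is_quandle (dihedral_quandle n)"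
proof -
  have inv: "(2 * x - (2 * x - y) mod int n) mod int n = y"
    if "y \<in> {0..<int n}" for x y
  proof -
    have "(2 * x - (2 * x - y) mod int n) mod int n = (2 * x - (2 * x - y)) mod int n"
      by (rule mod_diff_right_eq)
    also have "\<dots> = y" using that by simp
    finally show ?thesis .
  qed
  have "bij_betw (\<lambda>y. (2 * x - y) mod int n) {0..<int n} {0..<int n}" for x
    by (rule bij_betw_byWitness[where f' = "\<lambda>y. (2 * x - y) mod int n"])
       (use assms inv in auto)
  moreover have "(2 * z - (2 * y - x) mod int n) mod int n =
      (2 * ((2 * z - y) mod int n) - (2 * z - x) mod int n) mod int n" for x y z
  proof -
    have "(2 * ((2 * z - y) mod int n) - (2 * z - x) mod int n) mod int n =
        (2 * (2 * z - y) - (2 * z - x)) mod int n"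
      by (rule mod_diff_cong) (simp_all only: mod_mult_right_eq mod_mod_trivial)
    also have "\<dots> = (2 * z - (2 * y - x)) mod int n" by (simp add: algebra_simps)
    finally show ?thesis by (simp add: mod_diff_right_eq)
  qed
  moreover have "(2 * x - x) mod int n = x" if "x \<in> {0..<int n}" for x
    using that by simp
  ultimately show ?thesis
    unfolding is_quandle_def dihedral_quandle_def quandle.simps
    using assms by (intro conjI ballI) auto
qed

section \<open>Link diagrams and the fundamental quandle\<close>

text \<open>An oriented link diagram enters only through its arcs and, at each crossing, the sign, the
  over-arc and the incoming and outgoing under-arcs.\<close>

record 'a crossing =
  positive :: bool
  over_arc :: 'a
  under_in :: 'a
  under_out :: 'a

record 'a link_diagram =
  diagram_arcs :: "'a set"
  crossings :: "'a crossing set"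

datatype 'a qterm =
    Gen 'a
  | Op "'a qterm" "'a qterm"
  | OpBar "'a qterm" "'a qterm"

definition qterms :: "'a link_diagram \<Rightarrow> 'a qterm set" where
  "qterms D = {t. set_qterm t \<subseteq> diagram_arcs D}"

text \<open>The least congruence on quandle words in the arcs that contains the quandle axioms and the
  crossing relations (guarded so that only words in the arcs occur).  The rules \<open>op_opbar\<close> and
  \<open>opbar_op\<close> say that right multiplication by \<open>y\<close> is a bijection with inverse \<open>OpBar _ y\<close>.\<close>

inductive_set qrel :: "'a link_diagram \<Rightarrow> ('a qterm \<times> 'a qterm) set"
  for D :: "'a link_diagram"
where
  refl: "s \<in> qterms D \<Longrightarrow> (s, s) \<in> qrel D"
| sym: "(s, t) \<in> qrel D \<Longrightarrow> (t, s) \<in> qrel D"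
| trans: "(s, t) \<in> qrel D \<Longrightarrow> (t, u) \<in> qrel D \<Longrightarrow> (s, u) \<in> qrel D"
| cong_op: "(s, s') \<in> qrel D \<Longrightarrow> (t, t') \<in> qrel D \<Longrightarrow> (Op s t, Op s' t') \<in> qrel D"
| cong_opbar: "(s, s') \<in> qrel D \<Longrightarrow> (t, t') \<in> qrel D \<Longrightarrow> (OpBar s t, OpBar s' t') \<in> qrel D"
| distrib: "x \<in> qterms D \<Longrightarrow> y \<in> qterms D \<Longrightarrow> z \<in> qterms D \<Longrightarrow>
    (Op (Op x y) z, Op (Op x z) (Op y z)) \<in> qrel D"
| op_opbar: "x \<in> qterms D \<Longrightarrow> y \<in> qterms D \<Longrightarrow> (Op (OpBar x y) y, x) \<in> qrel D"
| opbar_op: "x \<in> qterms D \<Longrightarrow> y \<in> qterms D \<Longrightarrow> (OpBar (Op x y) y, x) \<in> qrel D"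
| idem: "x \<in> qterms D \<Longrightarrow> (Op x x, x) \<in> qrel D"
| positive_crossing: "c \<in> crossings D \<Longrightarrow> positive c \<Longrightarrow>
    {over_arc c, under_in c, under_out c} \<subseteq> diagram_arcs D \<Longrightarrow>
    (Gen (under_out c), Op (Gen (under_in c)) (Gen (over_arc c))) \<in> qrel D"
| negative_crossing: "c \<in> crossings D \<Longrightarrow> \<not> positive c \<Longrightarrow>
    {over_arc c, under_in c, under_out c} \<subseteq> diagram_arcs D \<Longrightarrow>
    (Gen (under_out c), OpBar (Gen (under_in c)) (Gen (over_arc c))) \<in> qrel D"

definition fundamental_quandle :: "'a link_diagram \<Rightarrow> 'a qterm set quandle" where
  "fundamental_quandle D =
     \<lparr>qcarrier = qterms D // qrel D,
      qop = (\<lambda>A B. qrel D `` {Op s t | s t. s \<in> A \<and> t \<in> B})\<rparr>"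

lemma qterms_simps [simp]:
  "Gen a \<in> qterms D \<longleftrightarrow> a \<in> diagram_arcs D"
  "Op s t \<in> qterms D \<longleftrightarrow> s \<in> qterms D \<and> t \<in> qterms D"
  "OpBar s t \<in> qterms D \<longleftrightarrow> s \<in> qterms D \<and> t \<in> qterms D"
  by (auto simp: qterms_def)

lemma qrel_in_qterms: "(s, t) \<in> qrel D \<Longrightarrow> s \<in> qterms D \<and> t \<in> qterms D"
  by (induction rule: qrel.induct) auto

lemma equiv_qrel: "equiv (qterms D) (qrel D)"
proof (rule equivI)
  show "qrel D \<subseteq> qterms D \<times> qterms D" by (auto dest: qrel_in_qterms)
  show "refl_on (qterms D) (qrel D)" by (rule refl_onI) (rule qrel.refl)
  show "sym_on UNIV (qrel D)" by (rule symI) (rule qrel.sym)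
  show "trans_on UNIV (qrel D)" by (rule transI) (rule qrel.trans)
qed

lemma qop_fundamental_quandle:
  assumes "s \<in> qterms D" "t \<in> qterms D"
  shows "qop (fundamental_quandle D) (qrel D `` {s}) (qrel D `` {t}) = qrel D `` {Op s t}"
proof -
  have "(Op s t, u) \<in> qrel D"
    if "(s, s') \<in> qrel D" "(t, t') \<in> qrel D" "(Op s' t', u) \<in> qrel D" for s' t' u
    using qrel.trans[OF qrel.cong_op[OF that(1,2)] that(3)] .
  moreover have "\<exists>s' t'. (s, s') \<in> qrel D \<and> (t, t') \<in> qrel D \<and> (Op s' t', u) \<in> qrel D"
    if "(Op s t, u) \<in> qrel D" for u
    using that qrel.refl[OF assms(1)] qrel.refl[OF assms(2)] by blast
  ultimately show ?thesis
    unfolding fundamental_quandle_def by fastforce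
qed

lemma is_quandle_fundamental_quandle: "is_quandle (fundamental_quandle D)"
proof -
  let ?Q = "fundamental_quandle D" and ?c = "\<lambda>s. qrel D `` {s}"
  have carrier: "qcarrier ?Q = ?c ` qterms D"
    by (auto simp: fundamental_quandle_def quotient_def)
  have eq: "?c s = ?c t" if "(s, t) \<in> qrel D" for s t
    using equiv_class_eq[OF equiv_qrel that] .
  have bij: "bij_betw (\<lambda>y. qop ?Q y (?c x)) (?c ` qterms D) (?c ` qterms D)"
    if x: "x \<in> qterms D" for x
  proof (rule bij_betwI')
    fix A B assume "A \<in> ?c ` qterms D" "B \<in> ?c ` qterms D"
    then obtain a b where ab: "a \<in> qterms D" "b \<in> qterms D" "A = ?c a" "B = ?c b" by auto
    have "(a, b) \<in> qrel D" if "(Op a x, Op b x) \<in> qrel D"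
      using qrel.cong_opbar[OF that qrel.refl[OF x]] qrel.opbar_op[OF ab(1) x]
        qrel.opbar_op[OF ab(2) x] by (meson qrel.sym qrel.trans)
    then show "(qop ?Q A (?c x) = qop ?Q B (?c x)) = (A = B)"
      using ab x by (auto simp: qop_fundamental_quandle eq_equiv_class_iff[OF equiv_qrel]
          intro: qrel.cong_op[OF _ qrel.refl[OF x]])
  next
    fix A assume "A \<in> ?c ` qterms D"
    then show "qop ?Q A (?c x) \<in> ?c ` qterms D" using x by (auto simp: qop_fundamental_quandle)
  next
    fix A assume "A \<in> ?c ` qterms D"
    then obtain a where a: "a \<in> qterms D" "A = ?c a" by auto
    then have "A = qop ?Q (?c (OpBar a x)) (?c x)"
      using x eq[OF qrel.op_opbar[OF a(1) x]] by (simp add: qop_fundamental_quandle)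
    then show "\<exists>B\<in>?c ` qterms D. A = qop ?Q B (?c x)" using a x by auto
  qed
  have dist: "qop ?Q (qop ?Q A B) C = qop ?Q (qop ?Q A C) (qop ?Q B C)"
    if ABC: "A \<in> ?c ` qterms D" "B \<in> ?c ` qterms D" "C \<in> ?c ` qterms D" for A B C
  proof -
    obtain a b c where abc: "a \<in> qterms D" "b \<in> qterms D" "c \<in> qterms D"
      and "A = ?c a" "B = ?c b" "C = ?c c" using ABC by blast
    then have "qop ?Q (qop ?Q A B) C = ?c (Op (Op a b) c)"
      "qop ?Q (qop ?Q A C) (qop ?Q B C) = ?c (Op (Op a c) (Op b c))"
      by (simp_all add: qop_fundamental_quandle)
    then show ?thesis using eq[OF qrel.distrib[OF abc]] by simp
  qed
  have idem: "qop ?Q A A = A" if "A \<in> ?c ` qterms D" for A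
    using that eq[OF qrel.idem] by (auto simp: qop_fundamental_quandle)
  have closed: "qop ?Q A B \<in> ?c ` qterms D"
    if "A \<in> ?c ` qterms D" "B \<in> ?c ` qterms D" for A B
    using that by (auto simp: qop_fundamental_quandle)
  have bij': "bij_betw (\<lambda>y. qop ?Q y A) (?c ` qterms D) (?c ` qterms D)"
    if "A \<in> ?c ` qterms D" for A
    using that by (elim imageE) (simp only: bij)
  show ?thesis
    unfolding is_quandle_def carrier by (intro conjI ballI closed dist bij' idem)
qed

section \<open>Closed braids and torus links\<close>

text \<open>A braid word on strands \<open>1, \<dots>, p\<close> is a list of letters \<open>(e, j)\<close>, where \<open>(True, j)\<close> is
  \<open>\<sigma>\<^sub>j\<close> and \<open>(False, j)\<close> its inverse, acting on the positions \<open>j\<close> and \<open>j + 1\<close>.  With all strands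
  oriented upwards, the over-strand of \<open>\<sigma>\<^sub>j\<close> runs from \<open>j\<close> to \<open>j + 1\<close>, which is a positive crossing;
  that of the inverse runs from \<open>j + 1\<close> to \<open>j\<close>, which is a negative crossing.  The under-strand runs
  the opposite way.  The segment \<open>(k, i)\<close> is the piece of strand at position \<open>i\<close> after the first
  \<open>k\<close> letters.\<close>

type_synonym braid_word = "(bool \<times> nat) list"
type_synonym segment = "nat \<times> nat"

fun over_from :: "bool \<times> nat \<Rightarrow> nat" where
  "over_from (e, j) = (if e then j else j + 1)"

fun over_to :: "bool \<times> nat \<Rightarrow> nat" where
  "over_to (e, j) = (if e then j + 1 else j)"

definition segments :: "nat \<Rightarrow> braid_word \<Rightarrow> segment set" where
  "segments p w = {0..length w} \<times> {1..p}"

text \<open>Two segments are glued if they are joined without passing under a crossing: along an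
  over-strand, along a strand not involved in a letter, or along a closing strand.\<close>

definition glue :: "nat \<Rightarrow> braid_word \<Rightarrow> (segment \<times> segment) set" where
  "glue p w =
     {((k, over_from (w ! k)), (Suc k, over_to (w ! k))) | k. k < length w} \<union>
     {((k, i), (Suc k, i)) | k i. k < length w \<and> i \<in> {1..p} \<and>
        i \<noteq> over_from (w ! k) \<and> i \<noteq> over_to (w ! k)} \<union>
     {((length w, i), (0, i)) | i. i \<in> {1..p}}"

definition arc_of :: "nat \<Rightarrow> braid_word \<Rightarrow> segment \<Rightarrow> segment set" where
  "arc_of p w s = (glue p w \<union> (glue p w)\<inverse>)\<^sup>* `` {s}"

definition braid_closure :: "nat \<Rightarrow> braid_word \<Rightarrow> segment set link_diagram" where
  "braid_closure p w =
     \<lparr>diagram_arcs = arc_of p w ` segments p w,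
      crossings = (\<lambda>k.
        \<lparr>positive = fst (w ! k),
         over_arc = arc_of p w (k, over_from (w ! k)),
         under_in = arc_of p w (k, over_to (w ! k)),
         under_out = arc_of p w (Suc k, over_from (w ! k))\<rparr>) ` {..<length w}\<rparr>"

definition torus_link :: "nat \<Rightarrow> nat \<Rightarrow> segment set link_diagram" where
  "torus_link p q = braid_closure p (concat (replicate q (map (\<lambda>j. (True, j)) [1..<p])))"

section \<open>Quandle coloring quivers\<close>

text \<open>The edge \<open>(f, \<phi>)\<close> is the one from \<open>f\<close> to \<open>\<phi> \<circ> f\<close>; parallel edges are kept apart by \<open>\<phi>\<close>.\<close>

definition full_coloring_quiver ::
  "'b quandle \<Rightarrow> 'a link_diagram \<Rightarrow>
    ('a qterm set \<Rightarrow> 'b, ('a qterm set \<Rightarrow> 'b) \<times> ('b \<Rightarrow> 'b)) pre_digraph" where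
  "full_coloring_quiver X D =
     \<lparr>verts = quandle_hom (fundamental_quandle D) X,
      arcs = quandle_hom (fundamental_quandle D) X \<times> quandle_hom X X,
      tail = fst,
      head = (\<lambda>(f, \<phi>). compose (qcarrier (fundamental_quandle D)) \<phi> f)\<rparr>"

definition complete_multidigraph :: "nat \<Rightarrow> nat \<Rightarrow> (nat, nat \<times> nat \<times> nat) pre_digraph" where
  "complete_multidigraph m \<omega> =
     \<lparr>verts = {..<m},
      arcs = {..<m} \<times> {..<m} \<times> {..<\<omega>},
      tail = (\<lambda>(i, j, k). i),
      head = (\<lambda>(i, j, k). j)\<rparr>"

definition copies :: "nat \<Rightarrow> ('a, 'b) pre_digraph \<Rightarrow> (nat \<times> 'a, nat \<times> 'b) pre_digraph" where
  "copies m G =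
     \<lparr>verts = {..<m} \<times> verts G,
      arcs = {..<m} \<times> arcs G,
      tail = map_prod id (tail G),
      head = map_prod id (head G)\<rparr>"

text \<open>The two graphs are made disjoint by the tags \<open>Inl\<close> and \<open>Inr\<close>; the edges \<open>Inr (v, u, k)\<close> with
  \<open>k < d\<close> are the additional ones from \<open>v\<close> in \<open>G\<^sub>2\<close> to \<open>u\<close> in \<open>G\<^sub>1\<close>.\<close>

definition directed_join ::
  "nat \<Rightarrow> ('a, 'b) pre_digraph \<Rightarrow> ('c, 'd) pre_digraph \<Rightarrow>
    ('a + 'c, ('b + 'd) + ('c \<times> 'a \<times> nat)) pre_digraph" where
  "directed_join d G\<^sub>1 G\<^sub>2 =
     \<lparr>verts = verts G\<^sub>1 <+> verts G\<^sub>2,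
      arcs = (arcs G\<^sub>1 <+> arcs G\<^sub>2) <+> (verts G\<^sub>2 \<times> verts G\<^sub>1 \<times> {..<d}),
      tail = case_sum (map_sum (tail G\<^sub>1) (tail G\<^sub>2)) (\<lambda>(v, u, k). Inr v),
      head = case_sum (map_sum (head G\<^sub>1) (head G\<^sub>2)) (\<lambda>(v, u, k). Inl u)\<rparr>"

end

(* A coloring of the closed braid is a fixed vector of the braid action on (Z/n)^p. For the torus
   braid one turn is x_i -> 2 x_1 - x_(i+1) with cyclic indices, so its q-th power is explicit. The
   assumption on the number of colorings then forces all colors of a coloring to agree modulo n/2:
   if p is odd and does not divide q, the colors form an arithmetic progression whose difference is
   killed by p, which leaves too few colorings; if p is odd and divides q, the fixed point equation
   says that all 2 x_i coincide (q odd) or is empty, which leaves too many colorings unless n = 2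
   (q even). So a coloring is determined by x_1 and the set of strands whose color is not x_1, and
   by counting every such pair occurs. The endomorphisms of R_n are the n^2 affine maps a x + b:
   for odd a the set of deviating strands is kept, for even a it becomes empty. This gives the
   number of edges between any two vertices, and these numbers determine the quiver. *)

theory Submission
  imports Defs "HOL-Number_Theory.Cong"
begin

section \<open>Digraph isomorphism from edge multiplicities\<close>

text \<open>For each ordered pair of vertices the two edge sets are finite and of equal size. Chosen
  bijections for all pairs glue to one arc map, because every arc has exactly one pair of ends.
  Hence edges need only be counted.\<close>

lemma digraph_iso_of_multiplicities:
  assumes wfG: "wf_digraph G" and wfH: "wf_digraph H"
    and fin: "finite (arcs G)" "finite (arcs H)"
    and v: "bij_betw v (verts G) (verts H)"
    and mult: "\<And>x y. x \<in> verts G \<Longrightarrow> y \<in> verts G \<Longrightarrow>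
      card {a \<in> arcs G. tail G a = x \<and> head G a = y} =
      card {a \<in> arcs H. tail H a = v x \<and> head H a = v y}"
  shows "digraph_iso G H"
proof -
  define AG where "AG x y = {a \<in> arcs G. tail G a = x \<and> head G a = y}" for x y
  define AH where "AH x y = {a \<in> arcs H. tail H a = x \<and> head H a = y}" for x y
  have "\<exists>b. x \<in> verts G \<and> y \<in> verts G \<longrightarrow> bij_betw b (AG x y) (AH (v x) (v y))" for x y
    using finite_same_card_bij[of "AG x y" "AH (v x) (v y)"] fin mult[of x y]
    by (auto simp: AG_def AH_def)
  then obtain b where b:
    "\<And>x y. x \<in> verts G \<Longrightarrow> y \<in> verts G \<Longrightarrow> bij_betw (b x y) (AG x y) (AH (v x) (v y))"
    by metis
  define e where "e a = b (tail G a) (head G a) a" for a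
  have ends: "tail G a \<in> verts G" "head G a \<in> verts G" if "a \<in> arcs G" for a
    using wfG that by (auto simp: wf_digraph_def)
  have ends': "tail H a \<in> verts H" "head H a \<in> verts H" if "a \<in> arcs H" for a
    using wfH that by (auto simp: wf_digraph_def)
  have e: "e a \<in> AH (v (tail G a)) (v (head G a))" if "a \<in> arcs G" for a
    using b[OF ends[OF that]] that unfolding e_def AG_def by (auto dest!: bij_betwE)
  have inj: "inj_on e (arcs G)"
  proof (rule inj_onI)
    fix a a' assume a: "a \<in> arcs G" "a' \<in> arcs G" "e a = e a'"
    then have "v (tail G a) = v (tail G a')" "v (head G a) = v (head G a')"
      using e[OF a(1)] e[OF a(2)] by (auto simp: AH_def)
    then have eq: "tail G a = tail G a'" "head G a = head G a'"
      using ends a v by (auto simp: bij_betw_def dest: inj_onD)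
    then show "a = a'"
      using a b[OF ends[OF a(1)]] unfolding e_def bij_betw_def
      by (auto simp: AG_def dest!: inj_onD)
  qed
  have "e ` arcs G = arcs H"
  proof
    show "e ` arcs G \<subseteq> arcs H" using e by (auto simp: AH_def)
    show "arcs H \<subseteq> e ` arcs G"
    proof
      fix a assume a: "a \<in> arcs H"
      obtain x y where xy: "x \<in> verts G" "y \<in> verts G" "tail H a = v x" "head H a = v y"
        using ends'[OF a] v unfolding bij_betw_def by (metis imageE)
      then have "a \<in> b x y ` AG x y"
        using a b[OF xy(1,2)] by (auto simp: AH_def bij_betw_def)
      then show "a \<in> e ` arcs G" by (auto simp: e_def AG_def)
    qed
  qed
  then show ?thesis
    unfolding digraph_iso_def pre_digraph.digraph_isomorphism_def app_iso_def
    using wfG inj v e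
    \<comment> \<open>The image graph takes its \<open>head\<close> and \<open>tail\<close> from the
      isomorphism record, so those of \<open>H\<close> are supplied.\<close>
    by (intro exI[of _ "\<lparr>iso_verts = v, iso_arcs = e, iso_head = head H, iso_tail = tail H\<rparr>"])
       (auto simp: bij_betw_def AH_def)
qed

section \<open>Colorings as homomorphisms\<close>

text \<open>The dihedral quandle is involutory: reflecting twice in the same element is the
  identity. So \<open>Op\<close> and \<open>OpBar\<close> evaluate alike, and crossings of either
  sign give the same equation in \<open>dihedral_colorings\<close>.\<close>

primrec dihedral_eval :: "nat \<Rightarrow> ('a \<Rightarrow> int) \<Rightarrow> 'a qterm \<Rightarrow> int" where
  "dihedral_eval n c (Gen a) = c a"
| "dihedral_eval n c (Op s t) = (2 * dihedral_eval n c t - dihedral_eval n c s) mod int n"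
| "dihedral_eval n c (OpBar s t) = (2 * dihedral_eval n c t - dihedral_eval n c s) mod int n"

definition dihedral_colorings :: "nat \<Rightarrow> 'a link_diagram \<Rightarrow> ('a \<Rightarrow> int) set" where
  "dihedral_colorings n D = {c \<in> diagram_arcs D \<rightarrow>\<^sub>E {0..<int n}.
     \<forall>x\<in>crossings D. c (under_out x) = (2 * c (over_arc x) - c (under_in x)) mod int n}"

abbreviation gen_class :: "'a link_diagram \<Rightarrow> 'a \<Rightarrow> 'a qterm set" where
  "gen_class D a \<equiv> qrel D `` {Gen a}"

lemma dihedral_involutory:
  "x \<in> {0..<int n} \<Longrightarrow> (2 * y - (2 * y - x) mod int n) mod int n = x"
  by (simp add: mod_diff_right_eq)

lemma dihedral_eval_range:
  assumes "n > 0" "c \<in> diagram_arcs D \<rightarrow> {0..<int n}" "t \<in> qterms D"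
  shows "dihedral_eval n c t \<in> {0..<int n}"
  using assms by (cases t) auto

text \<open>Each generating rule of the congruence holds in the dihedral quandle, the crossing rules
  because \<open>c\<close> is a coloring. Evaluation is therefore well defined on classes of
  words.\<close>

lemma dihedral_eval_qrel:
  assumes n: "n > 0" and c: "c \<in> dihedral_colorings n D" and st: "(s, t) \<in> qrel D"
  shows "dihedral_eval n c s = dihedral_eval n c t"
proof -
  have range: "dihedral_eval n c t \<in> {0..<int n}" if "t \<in> qterms D" for t
    by (rule dihedral_eval_range[OF n _ that]) (use c in \<open>auto simp: dihedral_colorings_def\<close>)
  note Q = is_quandle_dihedral[OF n, unfolded is_quandle_def dihedral_quandle_def quandle.simps]
  from st show ?thesis
  proof induction
    case (distrib x y z)
    then show ?case using Q range by simp
  next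
    case (op_opbar x y)
    then show ?case using range[of x] dihedral_involutory by simp
  next
    case (opbar_op x y)
    then show ?case using range[of x] dihedral_involutory by simp
  next
    case (idem x)
    then show ?case using range[of x] by simp
  qed (use c in \<open>auto simp: dihedral_colorings_def\<close>)
qed

lemma qcarrier_fundamental_quandle:
  "qcarrier (fundamental_quandle D) = (\<lambda>t. qrel D `` {t}) ` qterms D"
  by (auto simp: fundamental_quandle_def quotient_def)

lemma hom_dihedral_op:
  assumes "f \<in> quandle_hom (fundamental_quandle D) (dihedral_quandle n)"
    and "s \<in> qterms D" "t \<in> qterms D"
  shows "f (qrel D `` {Op s t}) = (2 * f (qrel D `` {t}) - f (qrel D `` {s})) mod int n"
  using assms unfolding qop_fundamental_quandle[OF assms(2,3), symmetric]
  by (simp add: quandle_hom_def qcarrier_fundamental_quandle dihedral_quandle_def)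

lemma hom_dihedral_range:
  assumes "f \<in> quandle_hom (fundamental_quandle D) (dihedral_quandle n)" "s \<in> qterms D"
  shows "f (qrel D `` {s}) \<in> {0..<int n}"
  using assms
  by (auto simp: quandle_hom_def qcarrier_fundamental_quandle dihedral_quandle_def Pi_iff PiE_def)

text \<open>A homomorphism is determined by its values on generators. Its defining equation does not
  mention \<open>OpBar\<close>, so that case starts from \<open>Op (OpBar s t) t\<close>, which is
  equivalent to \<open>s\<close>, and solves for the unknown value by reflecting once more.\<close>

lemma hom_dihedral_eq_eval:
  assumes f: "f \<in> quandle_hom (fundamental_quandle D) (dihedral_quandle n)" and s: "s \<in> qterms D"
  shows "f (qrel D `` {s}) = dihedral_eval n (\<lambda>a. f (gen_class D a)) s"
  using s
proof (induction s)
  case (OpBar s t)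
  then have q: "s \<in> qterms D" "t \<in> qterms D" "OpBar s t \<in> qterms D" by auto
  have "qrel D `` {Op (OpBar s t) t} = qrel D `` {s}"
    using equiv_class_eq[OF equiv_qrel qrel.op_opbar[OF q(1,2)]] .
  then have "f (qrel D `` {s}) = (2 * f (qrel D `` {t}) - f (qrel D `` {OpBar s t})) mod int n"
    using hom_dihedral_op[OF f q(3,2)] by simp
  then have "(2 * f (qrel D `` {t}) - f (qrel D `` {s})) mod int n = f (qrel D `` {OpBar s t})"
    using dihedral_involutory hom_dihedral_range[OF f q(3)] by simp
  then show ?case using OpBar q by simp
qed (simp_all add: hom_dihedral_op[OF f])

text \<open>Universal property of the presentation: restriction to the generators is injective
  because they determine the value of every word, and a coloring extends by evaluating
  words.\<close>

lemma bij_betw_hom_colorings: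
  assumes n: "n > 0"
    and D: "\<And>x. x \<in> crossings D \<Longrightarrow> {over_arc x, under_in x, under_out x} \<subseteq> diagram_arcs D"
  shows "bij_betw (\<lambda>f. \<lambda>a\<in>diagram_arcs D. f (gen_class D a))
    (quandle_hom (fundamental_quandle D) (dihedral_quandle n)) (dihedral_colorings n D)"
    (is "bij_betw ?r ?H ?C")
proof -
  have eqc: "qrel D `` {s} = qrel D `` {t}" if "(s, t) \<in> qrel D" for s t
    using equiv_class_eq[OF equiv_qrel that] .
  have eval_cong: "dihedral_eval n c s = dihedral_eval n c' s"
    if "\<And>a. a \<in> diagram_arcs D \<Longrightarrow> c a = c' a" "s \<in> qterms D" for c c' s
    using that(2) by (induction s) (auto simp: that(1))
  show ?thesis
  proof (rule bij_betw_imageI)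
    show "inj_on ?r ?H"
    proof (rule inj_onI)
      fix f g assume fg: "f \<in> ?H" "g \<in> ?H" "?r f = ?r g"
      then have gen: "f (gen_class D a) = g (gen_class D a)" if "a \<in> diagram_arcs D" for a
      proof -
        have "?r f a = ?r g a" by (simp only: fg(3))
        with that show ?thesis by simp
      qed
      have "f (qrel D `` {s}) = g (qrel D `` {s})" if "s \<in> qterms D" for s
        using hom_dihedral_eq_eval[OF fg(1) that] hom_dihedral_eq_eval[OF fg(2) that]
          eval_cong[OF gen that] by simp
      then show "f = g"
        using fg(1,2) unfolding quandle_hom_def qcarrier_fundamental_quandle
        by (intro extensionalityI[of f "(\<lambda>t. qrel D `` {t}) ` qterms D" g]) (auto simp: PiE_def)
    qed
    show "?r ` ?H = ?C"
    proof (intro equalityI image_subsetI subsetI)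
      fix f assume f: "f \<in> ?H"
      have "f (gen_class D (under_out x)) =
          (2 * f (gen_class D (over_arc x)) - f (gen_class D (under_in x))) mod int n"
        if x: "x \<in> crossings D" for x
      proof (cases "positive x")
        case True
        then show ?thesis
          using eqc[OF qrel.positive_crossing[OF x True D[OF x]]] D[OF x]
            hom_dihedral_op[OF f, of "Gen (under_in x)" "Gen (over_arc x)"] by simp
      next
        case False
        then show ?thesis
          using eqc[OF qrel.negative_crossing[OF x False D[OF x]]] D[OF x]
            hom_dihedral_eq_eval[OF f, of "OpBar (Gen (under_in x)) (Gen (over_arc x))"] by simp
      qed
      then show "?r f \<in> ?C"
        using D hom_dihedral_range[OF f] unfolding dihedral_colorings_def by auto
    next
      fix c assume c: "c \<in> ?C"
      \<comment> \<open>The value on a class is read from an arbitrary representative;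
        \<open>dihedral_eval_qrel\<close> makes the choice immaterial.\<close>
      define f where "f = (\<lambda>A\<in>qcarrier (fundamental_quandle D). dihedral_eval n c (SOME s. s \<in> A))"
      have f: "f (qrel D `` {s}) = dihedral_eval n c s" if s: "s \<in> qterms D" for s
      proof -
        have "(s, SOME t. t \<in> qrel D `` {s}) \<in> qrel D"
          using someI[of "\<lambda>t. t \<in> qrel D `` {s}" s] qrel.refl[OF s] by simp
        then show ?thesis
          using s dihedral_eval_qrel[OF n c] by (simp add: f_def qcarrier_fundamental_quandle)
      qed
      have range: "dihedral_eval n c t \<in> {0..<int n}" if "t \<in> qterms D" for t
        by (rule dihedral_eval_range[OF n _ that]) (use c in \<open>auto simp: dihedral_colorings_def\<close>)
      have "f \<in> ?H"
        unfolding quandle_hom_def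
      proof (intro CollectI conjI ballI)
        show "f \<in> qcarrier (fundamental_quandle D) \<rightarrow>\<^sub>E qcarrier (dihedral_quandle n)"
        proof (rule PiE_I)
          fix A assume "A \<in> qcarrier (fundamental_quandle D)"
          then show "f A \<in> qcarrier (dihedral_quandle n)"
            using range f by (auto simp: qcarrier_fundamental_quandle dihedral_quandle_def)
        qed (simp add: f_def)
        fix A B assume "A \<in> qcarrier (fundamental_quandle D)" "B \<in> qcarrier (fundamental_quandle D)"
        then obtain s t where st: "s \<in> qterms D" "t \<in> qterms D" "A = qrel D `` {s}" "B = qrel D `` {t}"
          unfolding qcarrier_fundamental_quandle by auto
        then show "f (qop (fundamental_quandle D) A B) = qop (dihedral_quandle n) (f A) (f B)"
          using qop_fundamental_quandle[OF st(1,2)] f by (simp add: dihedral_quandle_def)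
      qed
      moreover have "?r f = c"
      proof
        fix a show "?r f a = c a"
          using c f[of "Gen a"] by (auto simp: dihedral_colorings_def PiE_def extensional_def)
      qed
      ultimately show "c \<in> ?r ` ?H" by blast
    qed
  qed
qed

section \<open>Colorings of closed braids\<close>

text \<open>Action of one letter on a row of colors. The under-strand arrives at the position that
  the over-strand leaves, so the reflected color is stored at \<open>over_from l\<close>. The sign
  affects only the positions, since the quandle is involutory.\<close>

definition braid_step :: "nat \<Rightarrow> bool \<times> nat \<Rightarrow> (nat \<Rightarrow> int) \<Rightarrow> nat \<Rightarrow> int" where
  "braid_step n l x = x(over_to l := x (over_from l),
     over_from l := (2 * x (over_from l) - x (over_to l)) mod int n)"

definition braid_fixed :: "nat \<Rightarrow> nat \<Rightarrow> braid_word \<Rightarrow> (nat \<Rightarrow> int) set" where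
  "braid_fixed n p w =
     {x \<in> {1..p} \<rightarrow>\<^sub>E {0..<int n}. \<forall>i\<in>{1..p}. fold (braid_step n) w x i = x i}"

lemma braid_step_simps:
  "braid_step n l x (over_from l) = (2 * x (over_from l) - x (over_to l)) mod int n"
  "braid_step n l x (over_to l) = x (over_from l)"
  "i \<noteq> over_from l \<Longrightarrow> i \<noteq> over_to l \<Longrightarrow> braid_step n l x i = x i"
  by (cases l; auto simp: braid_step_def)+

lemma fold_take_Suc:
  "k < length w \<Longrightarrow> fold f (take (Suc k) w) x = f (w ! k) (fold f (take k w) x)"
  by (simp add: take_Suc_conv_app_nth)

lemma over_strand_positions:
  assumes "1 \<le> snd l" "snd l < p"
  shows "over_from l \<in> {1..p}" "over_to l \<in> {1..p}"
  using assms by (cases l; auto)+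

lemma equiv_arc_of: "equiv UNIV ((glue p w \<union> (glue p w)\<inverse>)\<^sup>*)"
  by (intro equivI refl_rtrancl trans_rtrancl sym_rtrancl) (auto simp: sym_def)

lemma arc_of_glue: "(s, t) \<in> glue p w \<Longrightarrow> arc_of p w s = arc_of p w t"
  unfolding arc_of_def by (rule equiv_class_eq[OF equiv_arc_of]) auto

text \<open>Arcs are the classes generated by \<open>glue\<close>, so colors of segments descend to
  arcs once they respect single gluings.\<close>

lemma arc_of_invariant:
  assumes g: "\<And>s t. (s, t) \<in> glue p w \<Longrightarrow> g s = g t" and t: "t \<in> arc_of p w s"
  shows "g t = g s"
proof -
  have "(s, t) \<in> (glue p w \<union> (glue p w)\<inverse>)\<^sup>*" using t by (simp add: arc_of_def)
  then show ?thesis by induction (use g in auto)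
qed

text \<open>Read upwards, each letter computes the next row of colors from the previous one, so the
  bottom row determines the coloring. The closing strands demand that the top row equals the bottom
  row.\<close>

lemma bij_betw_colorings_braid_fixed:
  assumes n: "n > 0" and w: "\<And>l. l \<in> set w \<Longrightarrow> 1 \<le> snd l \<and> snd l < p"
  shows "bij_betw (\<lambda>c. \<lambda>i\<in>{1..p}. c (arc_of p w (0, i)))
    (dihedral_colorings n (braid_closure p w)) (braid_fixed n p w)"
    (is "bij_betw ?r ?C ?F")
proof -
  let ?D = "braid_closure p w" and ?st = "\<lambda>x k. fold (braid_step n) (take k w) x"
  have pos: "over_from (w ! k) \<in> {1..p}" "over_to (w ! k) \<in> {1..p}" if "k < length w" for k
    using over_strand_positions w[OF nth_mem[OF that]] by blast+
  have arc: "arc_of p w (k, i) \<in> diagram_arcs ?D" if "k \<le> length w" "i \<in> {1..p}" for k i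
    using that by (auto simp: braid_closure_def segments_def)
  have over: "arc_of p w (Suc k, over_to (w ! k)) = arc_of p w (k, over_from (w ! k))"
    if "k < length w" for k
    by (rule arc_of_glue[symmetric]) (use that in \<open>auto simp: glue_def\<close>)
  have uninvolved: "arc_of p w (Suc k, i) = arc_of p w (k, i)"
    if "k < length w" "i \<in> {1..p}" "i \<noteq> over_from (w ! k)" "i \<noteq> over_to (w ! k)" for k i
    by (rule arc_of_glue[symmetric]) (use that in \<open>auto simp: glue_def\<close>)
  have closing: "arc_of p w (length w, i) = arc_of p w (0, i)" if "i \<in> {1..p}" for i
    by (rule arc_of_glue) (use that in \<open>auto simp: glue_def\<close>)
  have under: "c (arc_of p w (Suc k, over_from (w ! k))) =
      (2 * c (arc_of p w (k, over_from (w ! k))) - c (arc_of p w (k, over_to (w ! k)))) mod int n"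
    if "c \<in> ?C" "k < length w" for c k
    using that by (auto simp: dihedral_colorings_def braid_closure_def)
  have st: "c (arc_of p w (k, i)) = ?st (?r c) k i"
    if c: "c \<in> ?C" and "k \<le> length w" "i \<in> {1..p}" for c k i
    using that(2,3)
  proof (induction k arbitrary: i)
    case (Suc k)
    then have k: "k < length w" by simp
    note IH = Suc.IH[OF less_imp_le[OF k]]
    consider "i = over_from (w ! k)" | "i = over_to (w ! k)"
      | "i \<noteq> over_from (w ! k)" "i \<noteq> over_to (w ! k)" by blast
    then show ?case
    proof cases
      case 1
      show ?thesis
        unfolding 1 under[OF c k] fold_take_Suc[OF k] braid_step_simps
        by (simp only: IH[OF pos(1)[OF k]] IH[OF pos(2)[OF k]])
    next
      case 2
      show ?thesis
        unfolding 2 over[OF k] fold_take_Suc[OF k] braid_step_simps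
        by (rule IH[OF pos(1)[OF k]])
    next
      case 3
      show ?thesis
        unfolding uninvolved[OF k Suc.prems(2) 3] fold_take_Suc[OF k] braid_step_simps(3)[OF 3]
        by (rule IH[OF Suc.prems(2)])
    qed
  qed simp
  show ?thesis
  proof (rule bij_betw_imageI)
    show "inj_on ?r ?C"
    proof (rule inj_onI)
      fix c d assume cd: "c \<in> ?C" "d \<in> ?C" "?r c = ?r d"
      have "c a = d a" if "a \<in> diagram_arcs ?D" for a
        using that st[OF cd(1)] st[OF cd(2)] unfolding cd(3)
        by (auto simp: braid_closure_def segments_def)
      then show "c = d"
        using cd(1,2) unfolding dihedral_colorings_def
        by (intro extensionalityI[of c "diagram_arcs ?D" d]) (auto simp: PiE_def)
    qed
    show "?r ` ?C = ?F"
    proof (intro equalityI image_subsetI subsetI)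
      fix c assume c: "c \<in> ?C"
      have "fold (braid_step n) w (?r c) i = ?r c i" if "i \<in> {1..p}" for i
        using st[OF c order_refl that] closing[OF that] that by simp
      then show "?r c \<in> ?F"
        using c arc unfolding braid_fixed_def dihedral_colorings_def by auto
    next
      fix x assume x: "x \<in> ?F"
      define g where "g s = ?st x (fst s) (snd s)" for s
      \<comment> \<open>Gluing along a letter is respected by \<open>braid_step\<close>; gluing
        along a closing strand is respected because \<open>x\<close> is fixed.\<close>
      have glue: "g s = g t" if "(s, t) \<in> glue p w" for s t
        using that x unfolding glue_def g_def
        by (auto simp: braid_fixed_def fold_take_Suc braid_step_simps)
      have range: "?st x k i \<in> {0..<int n}" if "k \<le> length w" "i \<in> {1..p}" for k i
        using that
      proof (induction k arbitrary: i)
        case 0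
        then show ?case using x by (auto simp: braid_fixed_def)
      next
        case (Suc k)
        then have k: "k < length w" by simp
        consider "i = over_from (w ! k)" | "i = over_to (w ! k)"
          | "i \<noteq> over_from (w ! k)" "i \<noteq> over_to (w ! k)" by blast
        then show ?case
          using Suc pos[OF k] n
          by cases (simp_all add: fold_take_Suc[OF k] braid_step_simps del: atLeastAtMost_iff)
      qed
      define c where "c = (\<lambda>A\<in>diagram_arcs ?D. g (SOME s. s \<in> A))"
      have c: "c (arc_of p w (k, i)) = ?st x k i" if "k \<le> length w" "i \<in> {1..p}" for k i
      proof -
        have "(k, i) \<in> arc_of p w (k, i)" by (simp add: arc_of_def)
        then have "(SOME s. s \<in> arc_of p w (k, i)) \<in> arc_of p w (k, i)" by (rule someI)
        then show ?thesis
          using arc_of_invariant[of p w g, OF glue] arc[OF that] by (simp add: c_def g_def)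
      qed
      have "c \<in> ?C"
        unfolding dihedral_colorings_def
      proof (intro CollectI conjI ballI)
        show "c \<in> diagram_arcs ?D \<rightarrow>\<^sub>E {0..<int n}"
        proof (rule PiE_I)
          fix A assume "A \<in> diagram_arcs ?D"
          then obtain k i where "k \<le> length w" "i \<in> {1..p}" "A = arc_of p w (k, i)"
            by (auto simp: braid_closure_def segments_def)
          then show "c A \<in> {0..<int n}" using c range by simp
        qed (simp add: c_def)
        fix y assume "y \<in> crossings ?D"
        then obtain k where k: "k < length w" and y: "over_arc y = arc_of p w (k, over_from (w ! k))"
          "under_in y = arc_of p w (k, over_to (w ! k))"
          "under_out y = arc_of p w (Suc k, over_from (w ! k))"
          by (auto simp: braid_closure_def)
        show "c (under_out y) = (2 * c (over_arc y) - c (under_in y)) mod int n"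
          unfolding y using k pos[OF k] by (simp add: c fold_take_Suc braid_step_simps)
      qed
      moreover have "?r c = x"
        using x c[OF le0] by (auto simp: braid_fixed_def PiE_def extensional_def fun_eq_iff)
      ultimately show "x \<in> ?r ` ?C" by blast
    qed
  qed
qed

section \<open>Strand colors as coordinates of homomorphisms\<close>

definition strand_colors :: "nat \<Rightarrow> braid_word \<Rightarrow> (segment set qterm set \<Rightarrow> int) \<Rightarrow> nat \<Rightarrow> int" where
  "strand_colors p w f = (\<lambda>i\<in>{1..p}. f (gen_class (braid_closure p w) (arc_of p w (0, i))))"

lemma bij_betw_strand_colors:
  assumes n: "n > 0" and w: "\<And>l. l \<in> set w \<Longrightarrow> 1 \<le> snd l \<and> snd l < p"
  shows "bij_betw (strand_colors p w)
    (quandle_hom (fundamental_quandle (braid_closure p w)) (dihedral_quandle n)) (braid_fixed n p w)"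
proof -
  let ?D = "braid_closure p w"
  have arc: "arc_of p w (k, i) \<in> diagram_arcs ?D" if "k \<le> length w" "i \<in> {1..p}" for k i
    using that by (auto simp: braid_closure_def segments_def)
  have "{over_arc x, under_in x, under_out x} \<subseteq> diagram_arcs ?D" if x: "x \<in> crossings ?D" for x
  proof -
    obtain k where k: "k < length w" and y: "over_arc x = arc_of p w (k, over_from (w ! k))"
      "under_in x = arc_of p w (k, over_to (w ! k))"
      "under_out x = arc_of p w (Suc k, over_from (w ! k))"
      using x by (auto simp: braid_closure_def)
    have "over_from (w ! k) \<in> {1..p}" "over_to (w ! k) \<in> {1..p}"
      using over_strand_positions w[OF nth_mem[OF k]] by blast+
    then show ?thesis
      unfolding y using arc k by (simp del: atLeastAtMost_iff)
  qed
  note bij = bij_betw_trans[OF bij_betw_hom_colorings[OF n this] bij_betw_colorings_braid_fixed[OF n w]]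
  have "strand_colors p w =
      (\<lambda>c. \<lambda>i\<in>{1..p}. c (arc_of p w (0, i))) \<circ> (\<lambda>f. \<lambda>a\<in>diagram_arcs ?D. f (gen_class ?D a))"
    using arc[OF le0] by (auto simp: strand_colors_def fun_eq_iff)
  with bij show ?thesis by simp
qed

text \<open>Endomorphisms act entrywise on the row of colors, so the edges of the quiver can be
  studied on vectors.\<close>

lemma strand_colors_compose:
  assumes "f \<in> quandle_hom (fundamental_quandle (braid_closure p w)) X"
  shows "strand_colors p w (compose (qcarrier (fundamental_quandle (braid_closure p w))) \<phi> f) =
    compose {1..p} \<phi> (strand_colors p w f)"
proof -
  have "arc_of p w (0, i) \<in> diagram_arcs (braid_closure p w)" if "i \<in> {1..p}" for i
    using that by (auto simp: braid_closure_def segments_def)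
  then show ?thesis
    by (auto simp: strand_colors_def compose_def qcarrier_fundamental_quandle fun_eq_iff)
qed

section \<open>The action of the torus braid\<close>

text \<open>Indices start at 0: strand \<open>i\<close> has index \<open>i - 1\<close>, and
  reduction modulo \<open>p\<close> absorbs every wraparound.\<close>

definition cyclic :: "nat \<Rightarrow> (nat \<Rightarrow> int) \<Rightarrow> nat \<Rightarrow> int" where
  "cyclic p x j = x (Suc (j mod p))"

definition alt_sum :: "(nat \<Rightarrow> int) \<Rightarrow> nat \<Rightarrow> int" where
  "alt_sum X k = (\<Sum>j<k. (-1) ^ j * X j)"

lemma alt_sum_simps [simp]: "alt_sum X 0 = 0" "alt_sum X (Suc k) = alt_sum X k + (-1) ^ k * X k"
  by (simp_all add: alt_sum_def)

text \<open>The first strand passes over the following ones to position \<open>j\<close> and keeps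
  its color; each strand that it crosses is reflected in \<open>x 1\<close> and moves one position
  down.\<close>

lemma fold_torus_block:
  assumes "1 \<le> j" "1 \<le> i"
  shows "fold (braid_step n) (map (Pair True) [1..<j]) x i =
    (if i < j then (2 * x 1 - x (Suc i)) mod int n else if i = j then x 1 else x i)"
  using assms
proof (induction j arbitrary: i rule: nat_induct_at_least)
  case (Suc j)
  show ?case
    using Suc.prems Suc.IH Suc.hyps by (auto simp: braid_step_def)
qed simp

text \<open>The last position fits the reflection formula too: its color \<open>x 1\<close> equals
  \<open>2 * x 1 - x 1\<close>, and \<open>cyclic p x p\<close> is again \<open>x 1\<close>.\<close>

lemma fold_torus_block_cyclic:
  assumes p: "p > 0" and i: "i \<in> {1..p}" and x: "x 1 \<in> {0..<int n}"
  shows "fold (braid_step n) (map (Pair True) [1..<p]) x i =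
    (2 * x 1 - cyclic p x i) mod int n"
  using assms by (subst fold_torus_block) (auto simp: cyclic_def)

text \<open>One turn of the torus braid shifts the colors cyclically and reflects them in the first one.
  The iterates of this map are explicit.\<close>

lemma fold_torus_braid:
  assumes p: "p > 0" and n: "n > 0" and i: "i \<in> {1..p}" and x: "x \<in> {1..p} \<rightarrow> {0..<int n}"
  shows "fold (braid_step n) (concat (replicate q (map (Pair True) [1..<p]))) x i =
    (2 * alt_sum (cyclic p x) q + (-1) ^ q * cyclic p x (i - 1 + q)) mod int n"
  using i
proof (induction q arbitrary: i)
  case 0
  then show ?case using x by (auto simp: cyclic_def Pi_iff)
next
  case (Suc q)
  let ?B = "map (Pair True) [1..<p]" and ?A = "alt_sum (cyclic p x)"
  let ?y = "fold (braid_step n) (concat (replicate q ?B)) x"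
  \<comment> \<open>\<open>fold\<close> applies the last letters last, so the additional turn is
    split off at the end, after the \<open>q\<close> turns of the induction hypothesis.\<close>
  have comm: "concat (replicate (Suc q) ?B) = concat (replicate q ?B) @ ?B"
    by (induction q) auto
  have one: "1 \<in> {1..p}" using p by simp
  have y1: "?y 1 = (2 * ?A q + (-1) ^ q * cyclic p x q) mod int n"
    using Suc.IH[OF one] by simp
  have ci: "cyclic p ?y i = (2 * ?A q + (-1) ^ q * cyclic p x (i + q)) mod int n"
  proof -
    have "Suc (i mod p) \<in> {1..p}" using p by (simp add: Suc_le_eq)
    then have "cyclic p ?y i = (2 * ?A q + (-1) ^ q * cyclic p x (i mod p + q)) mod int n"
      unfolding cyclic_def[of p ?y] by (subst Suc.IH) auto
    then show ?thesis by (simp add: cyclic_def mod_simps)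
  qed
  have "fold (braid_step n) (concat (replicate (Suc q) ?B)) x i = fold (braid_step n) ?B ?y i"
    by (simp only: comm fold_append comp_apply)
  also have "\<dots> = (2 * ?y 1 - cyclic p ?y i) mod int n"
    by (rule fold_torus_block_cyclic[OF p Suc.prems]) (simp only: y1, use n in simp)
  also have "\<dots> = (2 * (2 * ?A q + (-1) ^ q * cyclic p x q)
      - (2 * ?A q + (-1) ^ q * cyclic p x (i + q))) mod int n"
    unfolding y1 ci by (intro mod_diff_cong) (simp_all add: mod_mult_right_eq)
  also have "\<dots> = (2 * ?A (Suc q) + (-1) ^ Suc q * cyclic p x (i - 1 + Suc q)) mod int n"
    using Suc.prems by (simp add: algebra_simps)
  finally show ?case .
qed

definition torus_word :: "nat \<Rightarrow> nat \<Rightarrow> braid_word" where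
  "torus_word p q = concat (replicate q (map (Pair True) [1..<p]))"

lemma torus_link_eq: "torus_link p q = braid_closure p (torus_word p q)"
  by (simp add: torus_link_def torus_word_def)

lemma torus_word_letters: "l \<in> set (torus_word p q) \<Longrightarrow> 1 \<le> snd l \<and> snd l < p"
  by (auto simp: torus_word_def split: if_splits)

text \<open>Periodicity extends the conditions on the \<open>p\<close> strands to all natural
  indices, so that they can be shifted and subtracted without boundary cases.\<close>

lemma torus_fixed_iff:
  assumes p: "p > 0" and n: "n > 0" and x: "x \<in> {1..p} \<rightarrow>\<^sub>E {0..<int n}"
  shows "x \<in> braid_fixed n p (torus_word p q) \<longleftrightarrow>
    (\<forall>i. int n dvd 2 * alt_sum (cyclic p x) q + (-1) ^ q * cyclic p x (i + q) - cyclic p x i)"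
    (is "_ \<longleftrightarrow> (\<forall>i. ?P i)")
proof -
  have P: "?P i \<longleftrightarrow> fold (braid_step n) (torus_word p q) x (Suc i) = x (Suc i)" if "i < p" for i
  proof -
    have i: "Suc i \<in> {1..p}" using that by simp
    then have "x (Suc i) \<in> {0..<int n}" using x by blast
    then have "x (Suc i) = x (Suc i) mod int n" by simp
    then show ?thesis
      using fold_torus_braid[OF p n i, of x q] x that
      unfolding torus_word_def mod_eq_dvd_iff[symmetric]
      by (auto simp: cyclic_def PiE_def)
  qed
  have "(\<forall>i. ?P i) \<longleftrightarrow> (\<forall>i<p. ?P i)"
  proof (intro iffI allI impI)
    fix i assume "\<forall>i<p. ?P i"
    then have "?P (i mod p)" using p by simp
    then show "?P i" by (simp add: cyclic_def mod_simps)
  qed simp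
  also have "\<dots> \<longleftrightarrow> (\<forall>i\<in>{1..p}. fold (braid_step n) (torus_word p q) x i = x i)"
    using P by (metis Suc_le_eq Suc_pred atLeastAtMost_iff le_simps(3) less_eq_Suc_le zero_less_Suc One_nat_def)
  finally show ?thesis using x by (simp add: braid_fixed_def)
qed

section \<open>The assumption on the number of colorings\<close>

lemma cyclic_add_mult: "p dvd q \<Longrightarrow> cyclic p x (i + q) = cyclic p x i"
  by (auto simp: cyclic_def)

lemma cyclic_add_period: "cyclic p x (p + i) = cyclic p x i"
  by (simp add: cyclic_def)

lemma cyclic_less: "i < p \<Longrightarrow> cyclic p x i = x (Suc i)"
  by (simp add: cyclic_def)

text \<open>This is the fixed point expression for two strands. \<open>X k + X (Suc k)\<close> is
  constant, so every further turn adds \<open>X 0 - X 1\<close>.\<close>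

lemma alt_sum_period_two:
  fixes X :: "nat \<Rightarrow> int"
  assumes X: "\<And>i. X (Suc (Suc i)) = X i"
  shows "2 * alt_sum X k + (-1) ^ k * X (i + k) - X i = int k * (X 0 - X 1)"
proof (induction k)
  case (Suc k)
  have sum: "X j + X (Suc j) = X 0 + X 1" for j
    by (induction j) (auto simp: X)
  have alt: "(-1) ^ k * (X k - X (Suc k)) = X 0 - X 1"
    by (induction k) (auto simp: X algebra_simps)
  have "2 * X k - X (Suc (i + k)) - X (i + k) = X k - X (Suc k)"
    using sum[of "i + k"] sum[of k] by simp
  then have "(-1) ^ k * (2 * X k - X (Suc (i + k)) - X (i + k)) = X 0 - X 1"
    by (simp only: alt)
  with Suc show ?case by (simp add: algebra_simps)
qed simp

text \<open>Shifting by an odd period reverses the alternating signs, so two consecutive periods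
  cancel.\<close>

lemma alt_sum_odd_period:
  assumes p: "odd p" and X: "\<And>i. X (p + i) = X i"
  shows "alt_sum X (2 * p * m) = 0"
proof -
  have flip: "alt_sum X (p + k) = alt_sum X p - alt_sum X k" for k
    by (induction k) (use p X in \<open>auto simp: power_add\<close>)
  have "alt_sum X (p + (p + k)) = alt_sum X k" for k
    using flip[of k] flip[of "p + k"] by simp
  moreover have "2 * p * Suc m = p + (p + 2 * p * m)" for m by simp
  ultimately show ?thesis by (induction m) (simp_all only: alt_sum_simps mult_0_right)
qed

section \<open>Bounds for the number of fixed vectors\<close>

lemma finite_braid_fixed: "finite (braid_fixed n p w)"
  by (rule finite_subset[of _ "{1..p} \<rightarrow>\<^sub>E {0..<int n}"])
     (auto simp: braid_fixed_def intro: finite_PiE)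

lemma less_two_power_pred: "p \<ge> 3 \<Longrightarrow> p < 2 ^ (p - 1)"
proof (induction p rule: nat_induct_at_least)
  case (Suc k)
  then obtain j where "k = Suc j" by (cases k) auto
  with Suc show ?case by simp
qed simp

lemma range_eq_of_dvd:
  "a \<in> {0..<int n} \<Longrightarrow> b \<in> {0..<int n} \<Longrightarrow> int n dvd a - b \<Longrightarrow> a = b"
  by (auto simp flip: mod_eq_dvd_iff)

text \<open>If \<open>p * u = n * k\<close> with \<open>u\<close> in range, then \<open>k\<close>
  lies between 0 and \<open>p - 1\<close>, and \<open>k\<close> determines \<open>u\<close>.\<close>

lemma card_torsion_le:
  assumes "n > 0" "p > 0"
  shows "card {u \<in> {0..<int n}. int n dvd int p * u} \<le> p"
proof -
  have "inj_on (\<lambda>u. int p * u div int n) {u \<in> {0..<int n}. int n dvd int p * u}"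
  proof (rule inj_onI)
    fix u v assume "u \<in> {u \<in> {0..<int n}. int n dvd int p * u}"
      "v \<in> {u \<in> {0..<int n}. int n dvd int p * u}" "int p * u div int n = int p * v div int n"
    then have "int p * u = int p * v" by (metis (no_types, lifting) dvd_mult_div_cancel mem_Collect_eq)
    then show "u = v" using assms by simp
  qed
  moreover have "(\<lambda>u. int p * u div int n) ` {u \<in> {0..<int n}. int n dvd int p * u} \<subseteq> {0..<int p}"
  proof safe
    fix u assume u: "u \<in> {0..<int n}" "int n dvd int p * u"
    then obtain k where k: "int p * u = int n * k" by (elim dvdE)
    have "int n * k < int n * int p" using u assms by (subst k[symmetric]) simp
    moreover have "0 \<le> int n * k" using u by (subst k[symmetric]) simp
    ultimately show "int p * u div int n \<in> {0..<int p}"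
      using assms k by (simp add: zero_le_mult_iff)
  qed
  ultimately have "card {u \<in> {0..<int n}. int n dvd int p * u} \<le> card {0..<int p}"
    by (rule card_inj_on_le) simp
  then show ?thesis by simp
qed

text \<open>If \<open>p\<close> is odd and does not divide \<open>q\<close>, then \<open>2q\<close> is invertible modulo \<open>p\<close>, which forces
  the colors of the strands to form an arithmetic progression.\<close>

lemma card_torus_fixed_coprime_le:
  assumes p: "prime p" "odd p" and pq: "\<not> p dvd q" and n: "n > 0"
  shows "card (braid_fixed n p (torus_word p q)) \<le> n * p"
proof -
  let ?F = "braid_fixed n p (torus_word p q)" and ?U = "{u \<in> {0..<int n}. int n dvd int p * u}"
  have p0: "p > 0" "p \<ge> 2" using p prime_gt_0_nat prime_ge_2_nat by auto
  have "coprime (2 * q) p"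
    using p pq by (simp add: prime_imp_coprime coprime_commute)
  \<comment> \<open>In a sequence of period \<open>p\<close>, a shift by \<open>2 * q * k\<close> is
    a shift by one.\<close>
  from cong_solve_coprime_nat[OF this] obtain k where k: "[2 * q * k = Suc 0] (mod p)" by blast
  have prog: "int n dvd cyclic p x i - cyclic p x 0 - int i * (cyclic p x 1 - cyclic p x 0)"
    if x: "x \<in> ?F" for x i
  proof -
    define X where "X = cyclic p x"
    define d where "d i = X (Suc i) - X i" for i
    have inv: "int n dvd 2 * alt_sum X q + (-1) ^ q * X (i + q) - X i" for i
      using x torus_fixed_iff[OF p0(1) n, of x q] by (auto simp: X_def braid_fixed_def)
    \<comment> \<open>Subtracting neighboring conditions removes the common term
      \<open>2 * alt_sum X q\<close>.\<close>
    have one: "int n dvd (-1) ^ q * d (i + q) - d i" for i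
      using dvd_diff[OF inv[of "Suc i"] inv[of i]] by (simp add: d_def algebra_simps)
    \<comment> \<open>Two shifts by \<open>q\<close> cancel the sign.\<close>
    have "int n dvd d (i + 2 * q) - d i" for i
    proof -
      have "int n dvd (-1) ^ q * ((-1) ^ q * d (i + q + q) - d (i + q)) + ((-1) ^ q * d (i + q) - d i)"
        by (intro dvd_add dvd_mult one)
      then show ?thesis by (simp add: algebra_simps mult_2 mult_2_right flip: power_add mult.assoc)
    qed
    then have two: "int n dvd d (i + 2 * q * k) - d i" for i
    proof (induction k)
      case (Suc k)
      have "int n dvd (d (i + 2 * q * k + 2 * q) - d (i + 2 * q * k)) + (d (i + 2 * q * k) - d i)"
        by (intro dvd_add Suc.IH Suc.prems)
      then show ?case by (simp add: algebra_simps)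
    qed simp
    have "d (i + 2 * q * k) = d (Suc i)" for i
    proof -
      have shift: "X (j + 2 * q * k) = X (Suc j)" for j
        using k cong_add[OF cong_refl[of j] k] by (simp add: X_def cyclic_def cong_def)
      show ?thesis using shift[of i] shift[of "Suc i"] by (simp add: d_def)
    qed
    with two have step: "int n dvd d (Suc i) - d i" for i by metis
    have const: "int n dvd d i - d 0" for i
    proof (induction i)
      case (Suc i)
      have "int n dvd (d (Suc i) - d i) + (d i - d 0)" by (intro dvd_add step Suc)
      then show ?case by simp
    qed simp
    have "int n dvd X i - X 0 - int i * d 0" for i
    proof (induction i)
      case (Suc i)
      have "int n dvd (X i - X 0 - int i * d 0) + (d i - d 0)" by (intro dvd_add const Suc)
      then show ?case by (simp add: d_def algebra_simps)
    qed simp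
    then show ?thesis by (simp add: X_def d_def)
  qed
  \<comment> \<open>The first color and the common difference modulo \<open>n\<close> recover the
    whole progression.\<close>
  define h where "h x = (cyclic p x 0, (cyclic p x 1 - cyclic p x 0) mod int n)" for x
  have X: "cyclic p x i \<in> {0..<int n}" if "x \<in> ?F" for x i
  proof -
    have "Suc (i mod p) \<in> {1..p}" using p0 by (simp add: Suc_le_eq)
    then show ?thesis using that unfolding braid_fixed_def cyclic_def by blast
  qed
  have "inj_on h ?F"
  proof (rule inj_onI)
    fix x y assume xy: "x \<in> ?F" "y \<in> ?F" "h x = h y"
    have eq: "cyclic p x i = cyclic p y i" for i
    proof -
      have 0: "cyclic p x 0 = cyclic p y 0" using xy(3) by (simp add: h_def)
      have "int n dvd (cyclic p x 1 - cyclic p x 0) - (cyclic p y 1 - cyclic p y 0)"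
        using xy(3) unfolding h_def mod_eq_dvd_iff[symmetric] prod.inject by blast
      from dvd_add[OF dvd_diff[OF prog[OF xy(1), of i] prog[OF xy(2), of i]] dvd_mult[OF this, of "int i"]]
      have "int n dvd (cyclic p x i - cyclic p x 0 - int i * (cyclic p x 1 - cyclic p x 0))
        - (cyclic p y i - cyclic p y 0 - int i * (cyclic p y 1 - cyclic p y 0))
        + int i * ((cyclic p x 1 - cyclic p x 0) - (cyclic p y 1 - cyclic p y 0))" .
      then have "int n dvd cyclic p x i - cyclic p y i"
        using 0 by (simp add: algebra_simps)
      then show ?thesis using range_eq_of_dvd X xy by blast
    qed
    have "x i = y i" if "i \<in> {1..p}" for i
      using eq[of "i - 1"] that by (cases i) (simp_all add: cyclic_less)
    then show "x = y"
      using xy by (intro extensionalityI[of x "{1..p}" y]) (auto simp: braid_fixed_def PiE_def)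
  qed
  moreover have "h ` ?F \<subseteq> {0..<int n} \<times> ?U"
  proof (rule image_subsetI)
    fix x assume x: "x \<in> ?F"
    \<comment> \<open>One full round, index \<open>p\<close>, returns to the first color, so
      \<open>p\<close> kills the difference modulo \<open>n\<close>.\<close>
    have "int n dvd int p * (cyclic p x 1 - cyclic p x 0)"
      using prog[OF x, of p] cyclic_add_period[of p x 0] by simp
    then have "int n dvd int p * ((cyclic p x 1 - cyclic p x 0) mod int n)"
      by (metis dvd_eq_mod_eq_0 mod_mult_right_eq)
    then show "h x \<in> {0..<int n} \<times> ?U"
      using X[OF x] n by (simp add: h_def)
  qed
  moreover have "finite ?U" by (rule finite_subset[of _ "{0..<int n}"]) auto
  ultimately have "card ?F \<le> card ({0..<int n} \<times> ?U)"
    by (intro card_inj_on_le[of h]) (auto intro: finite_cartesian_product)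
  also have "\<dots> = n * card ?U" by (simp add: card_cartesian_product)
  also have "\<dots> \<le> n * p" using card_torsion_le[OF n p0(1)] by simp
  finally show ?thesis .
qed

text \<open>For \<open>p = 2\<close> the difference \<open>\<delta>\<close> of the two colors is only constrained by \<open>n dvd q\<delta>\<close>.  If
  \<open>2\<delta>\<close> did not vanish, then \<open>0\<close>, \<open>\<delta>\<close> and \<open>-\<delta>\<close> would be three admissible differences.\<close>

lemma torus_fixed_two:
  assumes n: "n > 0" and card: "card (braid_fixed n 2 (torus_word 2 q)) = 2 * n"
    and x: "x \<in> braid_fixed n 2 (torus_word 2 q)"
  shows "int n dvd 2 * (x 2 - x 1)"
proof (rule ccontr)
  assume not: "\<not> int n dvd 2 * (x 2 - x 1)"
  let ?F = "braid_fixed n 2 (torus_word 2 q)"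
  define d where "d = x 2 - x 1"
  have iff: "y \<in> ?F \<longleftrightarrow> int n dvd int q * (y 1 - y 2)" if y: "y \<in> {1..2} \<rightarrow>\<^sub>E {0..<int n}" for y
  proof -
    have "cyclic 2 y (Suc (Suc i)) = cyclic 2 y i" for i by (simp add: cyclic_def)
    note alt_sum_period_two[of "cyclic 2 y", OF this]
    then show ?thesis
      unfolding torus_fixed_iff[OF pos2 n y] by (simp add: cyclic_def numeral_2_eq_2)
  qed
  \<comment> \<open>These are the vectors with differences \<open>-d\<close>, 0 and
    \<open>d\<close>: if distinct, they are \<open>3 * n\<close> fixed vectors against the assumed
    \<open>2 * n\<close>.\<close>
  define y where "y = (\<lambda>(c, t). \<lambda>i\<in>{1..2::nat}. if i = 1 then c else (c + t * d) mod int n)"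
  have image: "y ` ({0..<int n} \<times> {-1..1}) \<subseteq> ?F"
  proof (rule image_subsetI, clarify)
    fix c t assume c: "c \<in> {0..<int n}"
    have y: "y (c, t) \<in> {1..2} \<rightarrow>\<^sub>E {0..<int n}" using c n by (auto simp: y_def)
    have d: "int n dvd int q * d"
      using iff[of x] x by (auto simp: braid_fixed_def d_def algebra_simps dvd_diff_commute)
    have "int n dvd (c + t * d) mod int n - (c + t * d)"
      by (simp flip: mod_eq_dvd_iff)
    from dvd_diff[OF dvd_mult[OF d, of "- t"] dvd_mult[OF this, of "int q"]]
    have "int n dvd - t * (int q * d) - int q * ((c + t * d) mod int n - (c + t * d))" .
    then show "y (c, t) \<in> ?F"
      unfolding iff[OF y] by (simp add: y_def algebra_simps)
  qed
  have "inj_on y ({0..<int n} \<times> {-1..1})"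
  proof (rule inj_onI, clarify)
    fix c t c' t'
    assume t: "t \<in> {-1..1}" "t' \<in> {-1..1::int}" and eq: "y (c, t) = y (c', t')"
    from fun_cong[OF eq, of 1] have c: "c = c'" by (simp add: y_def)
    from fun_cong[OF eq, of 2] have "(c + t * d) mod int n = (c' + t' * d) mod int n"
      by (simp add: y_def)
    then have td: "int n dvd (t - t') * d" using c by (simp add: mod_eq_dvd_iff algebra_simps)
    \<comment> \<open>Distinct \<open>t\<close> and \<open>t'\<close> differ by a divisor of 2, so a
      coincidence would make \<open>n\<close> divide \<open>2 * d\<close>.\<close>
    moreover have "int n dvd 2 * d" if "t - t' \<in> {-2,-1,1,2}"
    proof -
      have "(t - t') dvd 2" using that by auto
      then have "(t - t') * d dvd 2 * d" by (rule mult_dvd_mono) simp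
      with td show ?thesis by (rule dvd_trans)
    qed
    ultimately have "t - t' \<notin> {-2,-1,1,2}" using not by (auto simp: d_def)
    then show "c = c' \<and> t = t'" using t c by auto
  qed
  from card_inj_on_le[OF this image finite_braid_fixed]
  have "card ({0..<int n} \<times> {-1..1::int}) \<le> card ?F" .
  then show False using n card by (simp add: card_cartesian_product)
qed

lemma torus_fixed_half_turn:
  assumes p: "prime p" and n: "n > 0"
    and card: "card (braid_fixed n p (torus_word p q)) = 2 ^ (p - 1) * n"
    and x: "x \<in> braid_fixed n p (torus_word p q)" and i: "i \<in> {1..p}"
  shows "int n dvd 2 * (x i - x 1)"
proof (cases "p = 2")
  case True
  then have "i = 1 \<or> i = 2" using i by auto
  then show ?thesis
    using torus_fixed_two[of n q x] n card x True by auto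
next
  case False
  then have p3: "p \<ge> 3" and odd: "odd p"
    using p prime_ge_2_nat[OF p] prime_odd_nat[OF p] by auto
  then have p0: "p > 0" by simp
  have "p dvd q"
  proof (rule ccontr)
    assume "\<not> p dvd q"
    from card_torus_fixed_coprime_le[OF p odd this n] have "2 ^ (p - 1) * n \<le> n * p"
      using card by simp
    moreover have "n * p < 2 ^ (p - 1) * n" using less_two_power_pred[OF p3] n by simp
    ultimately show False by simp
  qed
  show ?thesis
  proof (cases "even q")
    case False
    define A where "A = alt_sum (cyclic p x) q"
    \<comment> \<open>As \<open>p\<close> divides \<open>q\<close>, the shift by \<open>q\<close> is
      trivial; for odd \<open>q\<close> both terms in \<open>cyclic p x j\<close> are negative and
      add up.\<close>
    have "int n dvd 2 * A - 2 * cyclic p x j" for j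
      using torus_fixed_iff[OF p0 n, of x q] x cyclic_add_mult[OF \<open>p dvd q\<close>, of x] False
      by (auto simp: braid_fixed_def A_def)
    from dvd_diff[OF this[of 0] this[of "i - 1"]] have
      "int n dvd 2 * (cyclic p x (i - 1) - cyclic p x 0)" by (simp add: algebra_simps)
    moreover obtain j where "i = Suc j" using i by (cases i) auto
    ultimately show ?thesis using i p0 by (simp add: cyclic_less)
  next
    case True
    then obtain m where m: "q = 2 * p * m"
      using \<open>p dvd q\<close> odd by (metis coprime_left_2_iff_odd divides_mult dvdE mult.commute)
    \<comment> \<open>The alternating sum is zero and the shifted color cancels, so every vector is
      fixed; comparing counts then leaves only \<open>n = 2\<close>.\<close>
    have "braid_fixed n p (torus_word p q) = {1..p} \<rightarrow>\<^sub>E {0..<int n}"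
    proof (intro equalityI subsetI)
      fix y assume y: "y \<in> {1..p} \<rightarrow>\<^sub>E {0..<int n}"
      have "alt_sum (cyclic p y) q = 0"
        unfolding m using alt_sum_odd_period[of p "cyclic p y", OF odd cyclic_add_period] .
      then show "y \<in> braid_fixed n p (torus_word p q)"
        unfolding torus_fixed_iff[OF p0 n y] cyclic_add_mult[OF \<open>p dvd q\<close>] using True by simp
    qed (auto simp: braid_fixed_def)
    then have "n ^ p = 2 ^ (p - 1) * n" using card by (simp add: card_PiE)
    moreover have "n ^ p = n ^ (p - 1) * n" using p0 by (cases p) auto
    ultimately have "n ^ (p - 1) = 2 ^ (p - 1)" using n by simp
    then have "n = 2" using p3 power_eq_iff_eq_base[of "p - 1" n 2] by simp
    then show ?thesis by simp
  qed
qed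

section \<open>Endomorphisms of dihedral quandles\<close>

text \<open>The quandle product of \<open>k\<close> and \<open>k + 1\<close> is
  \<open>k + 2\<close>, so an endomorphism obeys a two-term recursion and is determined by its
  values at 0 and 1. Affine maps solve this recursion.\<close>

lemma quandle_hom_dihedral_eq:
  assumes n: "n > 0"
  shows "quandle_hom (dihedral_quandle n) (dihedral_quandle n) =
    (\<lambda>(a, b). \<lambda>x\<in>{0..<int n}. (a * x + b) mod int n) ` ({0..<int n} \<times> {0..<int n})"
    (is "?E = ?A ` _")
proof (intro equalityI subsetI)
  fix \<phi> assume \<phi>: "\<phi> \<in> ?E"
  then have range: "\<phi> x \<in> {0..<int n}" if "x \<in> {0..<int n}" for x
    using that unfolding quandle_hom_def dihedral_quandle_def by auto
  have op: "\<phi> ((2 * y - x) mod int n) = (2 * \<phi> y - \<phi> x) mod int n"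
    if "x \<in> {0..<int n}" "y \<in> {0..<int n}" for x y
    using \<phi> that by (simp add: quandle_hom_def dihedral_quandle_def)
  define b where "b = \<phi> 0"
  \<comment> \<open>\<open>1 mod int n\<close> lies in the carrier even for
    \<open>n = 1\<close>.\<close>
  define a where "a = (\<phi> (1 mod int n) - b) mod int n"
  have affine: "\<phi> (int k mod int n) = (a * int k + b) mod int n" for k
  proof (induction k rule: induct_nat_012)
    case 0
    then show ?case using range[of 0] n by (simp add: b_def)
  next
    case 1
    show ?case using range[of "1 mod int n"] n by (simp add: a_def mod_simps)
  next
    case (ge2 k)
    have "(2 * (int (Suc k) mod int n) - int k mod int n) mod int n = (2 * int (Suc k) - int k) mod int n"
      by (intro mod_diff_cong) (simp_all add: mod_mult_right_eq)
    moreover have "2 * int (Suc k) - int k = int (Suc (Suc k))" by simp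
    ultimately have "\<phi> (int (Suc (Suc k)) mod int n) =
        (2 * \<phi> (int (Suc k) mod int n) - \<phi> (int k mod int n)) mod int n"
      using op[of "int k mod int n" "int (Suc k) mod int n"] n
      by (metis atLeastLessThan_iff of_nat_0_less_iff pos_mod_bound pos_mod_sign)
    also have "\<dots> = (2 * (a * int (Suc k) + b) - (a * int k + b)) mod int n"
      unfolding ge2 by (intro mod_diff_cong) (simp_all add: mod_mult_right_eq)
    also have "\<dots> = (a * int (Suc (Suc k)) + b) mod int n" by (simp add: algebra_simps)
    finally show ?case .
  qed
  have "\<phi> = ?A (a, b)"
  proof
    fix x show "\<phi> x = ?A (a, b) x"
      using affine[of "nat x"] \<phi>
      by (auto simp: quandle_hom_def dihedral_quandle_def PiE_def extensional_def)
  qed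
  moreover have "a \<in> {0..<int n}" "b \<in> {0..<int n}"
    using n range[of 0] by (auto simp: a_def b_def)
  ultimately show "\<phi> \<in> ?A ` ({0..<int n} \<times> {0..<int n})" by blast
next
  fix \<phi> assume "\<phi> \<in> ?A ` ({0..<int n} \<times> {0..<int n})"
  then obtain a b where \<phi>: "\<phi> = ?A (a, b)" by auto
  have "(a * ((2 * y - x) mod int n) + b) mod int n =
      (2 * ((a * y + b) mod int n) - (a * x + b) mod int n) mod int n" for x y
  proof -
    have "(a * ((2 * y - x) mod int n) + b) mod int n = (a * (2 * y - x) + b) mod int n"
      by (intro mod_add_cong) (simp_all only: mod_mult_right_eq)
    also have "\<dots> = (2 * (a * y + b) - (a * x + b)) mod int n" by (simp add: algebra_simps)
    also have "\<dots> = (2 * ((a * y + b) mod int n) - (a * x + b) mod int n) mod int n"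
      by (intro mod_diff_cong) (simp_all add: mod_mult_right_eq)
    finally show ?thesis .
  qed
  then show "\<phi> \<in> ?E"
    using n by (auto simp: \<phi> quandle_hom_def dihedral_quandle_def)
qed

text \<open>The values at 0 and 1 recover \<open>b\<close> and then \<open>a\<close>; endomorphisms
  may thus be counted as pairs.\<close>

lemma inj_on_affine:
  assumes n: "n \<ge> 2"
  shows "inj_on (\<lambda>(a, b). \<lambda>x\<in>{0..<int n}. (a * x + b) mod int n) ({0..<int n} \<times> {0..<int n})"
proof (rule inj_onI, clarify)
  fix a b a' b' :: int
  assume range: "a \<in> {0..<int n}" "b \<in> {0..<int n}" "a' \<in> {0..<int n}" "b' \<in> {0..<int n}"
    and eq: "(\<lambda>x\<in>{0..<int n}. (a * x + b) mod int n) = (\<lambda>x\<in>{0..<int n}. (a' * x + b') mod int n)"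
  have b: "b = b'" using fun_cong[OF eq, of 0] range by simp
  have "(a + b) mod int n = (a' + b') mod int n" using fun_cong[OF eq, of 1] n by simp
  then have "int n dvd a - a'" using b by (simp add: mod_eq_dvd_iff)
  with range range_eq_of_dvd b show "a = a' \<and> b = b'" by blast
qed

lemma card_even_below: "even n \<Longrightarrow> card {a \<in> {0..<int n}. even a} = n div 2"
  and card_odd_below: "even n \<Longrightarrow> card {a \<in> {0..<int n}. odd a} = n div 2"
proof -
  assume "even n"
  then obtain m where m: "n = 2 * m" by (elim evenE)
  have "bij_betw (\<lambda>j. 2 * j) {0..<int m} {a \<in> {0..<int n}. even a}"
    by (rule bij_betw_byWitness[where f' = "\<lambda>a. a div 2"]) (auto simp: m)
  from bij_betw_same_card[OF this] show "card {a \<in> {0..<int n}. even a} = n div 2" by (simp add: m)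
  have "bij_betw (\<lambda>j. 2 * j + 1) {0..<int m} {a \<in> {0..<int n}. odd a}"
    by (rule bij_betw_byWitness[where f' = "\<lambda>a. a div 2"]) (auto simp: m elim!: oddE)
  from bij_betw_same_card[OF this] show "card {a \<in> {0..<int n}. odd a} = n div 2" by (simp add: m)
qed

text \<open>For even \<open>n\<close> the condition says that all colors lie in \<open>x 1 + {0, n div 2}\<close>.\<close>

definition half_turn :: "nat \<Rightarrow> nat \<Rightarrow> (nat \<Rightarrow> int) \<Rightarrow> bool" where
  "half_turn n p x \<longleftrightarrow> x \<in> {1..p} \<rightarrow>\<^sub>E {0..<int n} \<and> (\<forall>i\<in>{1..p}. int n dvd 2 * (x i - x 1))"

definition twisted :: "nat \<Rightarrow> (nat \<Rightarrow> int) \<Rightarrow> nat set" where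
  "twisted p x = {i \<in> {1..p}. x i \<noteq> x 1}"

text \<open>With \<open>n = 2 * m\<close> the color difference is \<open>m * k\<close>. If the
  colors differ, \<open>k\<close> is odd, since an even \<open>k\<close> would make them congruent
  modulo \<open>n\<close>; and odd multiples of \<open>m\<close> are congruent to
  \<open>m\<close>.\<close>

lemma half_turn_color:
  assumes n: "even n" "n > 0" and p: "p > 0" and x: "half_turn n p x" and i: "i \<in> {1..p}"
  shows "int n dvd x i - (x 1 + of_bool (i \<in> twisted p x) * int (n div 2))"
proof (cases "x i = x 1")
  case False
  from n obtain m where m: "n = 2 * m" "m > 0" by (elim evenE) auto
  have "int n dvd 2 * (x i - x 1)" using x i unfolding half_turn_def by blast
  then obtain k where "2 * (x i - x 1) = int n * k" by (elim dvdE)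
  then have k: "x i - x 1 = int m * k" by (simp add: m)
  have "1 \<in> {1..p}" using p by simp
  then have "x i \<in> {0..<int n}" "x 1 \<in> {0..<int n}" using x i unfolding half_turn_def by blast+
  then have "\<not> int n dvd x i - x 1" using False range_eq_of_dvd by blast
  then have "odd k" unfolding k m by simp
  then obtain j where "k = 2 * j + 1" by (elim oddE)
  then have "x i - (x 1 + int m) = int n * j" using k by (simp add: m algebra_simps)
  then show ?thesis using False i by (simp add: twisted_def m)
qed (simp add: twisted_def)

lemma half_turn_eqI:
  assumes n: "even n" "n > 0" and p: "p > 0" and xy: "half_turn n p x" "half_turn n p y"
    and "x 1 = y 1" "twisted p x = twisted p y"
  shows "x = y"
proof (rule extensionalityI[of _ "{1..p}"])
  fix i assume i: "i \<in> {1..p}"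
  from dvd_diff[OF half_turn_color[OF n p xy(1) i] half_turn_color[OF n p xy(2) i]]
  have "int n dvd x i - y i" using assms by simp
  moreover have "x i \<in> {0..<int n}" "y i \<in> {0..<int n}" using xy i unfolding half_turn_def by blast+
  ultimately show "x i = y i" using range_eq_of_dvd by blast
qed (use xy in \<open>auto simp: half_turn_def PiE_def\<close>)

text \<open>Modulo \<open>n = 2 * m\<close> each color is the first color plus \<open>m\<close>
  times the indicator of the twisted set. Once strand 1 matches, strand \<open>i\<close> matches iff
  \<open>a * tx i - ty i\<close> is even: odd \<open>a\<close> preserves the indicator, even
  \<open>a\<close> erases it.\<close>

lemma affine_half_turn_iff:
  assumes n: "even n" "n > 0" and p: "p > 0" and xy: "half_turn n p x" "half_turn n p y"
  shows "(\<forall>i\<in>{1..p}. (a * x i + b) mod int n = y i) \<longleftrightarrow>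
    (a * x 1 + b) mod int n = y 1 \<and> twisted p y = (if even a then {} else twisted p x)"
proof -
  from n obtain m where m: "n = 2 * m" "m > 0" by (elim evenE) auto
  have one: "1 \<in> {1..p}" using p by simp
  have y: "y i = y i mod int n" if "i \<in> {1..p}" for i
    using xy(2) that unfolding half_turn_def by (auto simp: PiE_def Pi_iff)
  define tx ty where "tx i = (of_bool (i \<in> twisted p x) :: int)"
    and "ty i = (of_bool (i \<in> twisted p y) :: int)" for i
  have step: "(a * x i + b) mod int n = y i \<longleftrightarrow> (even (a * tx i - ty i))"
    if one_eq: "(a * x 1 + b) mod int n = y 1" and i: "i \<in> {1..p}" for i
  proof -
    let ?u = "x i - (x 1 + tx i * int m)" and ?v = "y i - (y 1 + ty i * int m)"
      and ?w = "a * x 1 + b - y 1"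
    have w: "int n dvd ?w"
      using one_eq y[OF one] by (metis mod_eq_dvd_iff)
    have uv: "int n dvd ?u" "int n dvd ?v"
      using half_turn_color[OF n p xy(1) i] half_turn_color[OF n p xy(2) i]
      by (simp_all add: m tx_def ty_def)
    from dvd_add[OF dvd_diff[OF dvd_mult[OF uv(1), of a] uv(2)] w]
    have "int n dvd a * ?u - ?v + ?w" .
    moreover have "a * x i + b - y i = (a * ?u - ?v + ?w) + int m * (a * tx i - ty i)"
      by (simp add: algebra_simps)
    ultimately have "int n dvd a * x i + b - y i \<longleftrightarrow> int n dvd int m * (a * tx i - ty i)"
      by (simp only: dvd_add_right_iff)
    also have "\<dots> \<longleftrightarrow> even (a * tx i - ty i)" using m by (simp add: mult.commute[of 2])
    finally show ?thesis using y[OF i] by (metis mod_eq_dvd_iff)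
  qed
  have set: "(\<forall>i\<in>{1..p}. even (a * tx i - ty i)) \<longleftrightarrow>
      twisted p y = (if even a then {} else twisted p x)"
  proof -
    have sub: "twisted p x \<subseteq> {1..p}" "twisted p y \<subseteq> {1..p}" by (auto simp: twisted_def)
    have "even (a * tx i - ty i) \<longleftrightarrow> (i \<in> twisted p y \<longleftrightarrow> odd a \<and> i \<in> twisted p x)" for i
      by (auto simp: tx_def ty_def)
    then show ?thesis using sub by auto
  qed
  show ?thesis using step set one by blast
qed

text \<open>Strand 1 determines \<open>b\<close> from \<open>a\<close>, so only \<open>a\<close> is
  counted: even ones serve when \<open>twisted p y\<close> is empty, odd ones when it equals
  \<open>twisted p x\<close>, and each parity contributes \<open>n div 2\<close>.\<close>

lemma card_affine_maps_between:
  assumes n: "even n" "n > 0" and p: "p > 0" and xy: "half_turn n p x" "half_turn n p y"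
  shows "card {(a, b) \<in> {0..<int n} \<times> {0..<int n}. \<forall>i\<in>{1..p}. (a * x i + b) mod int n = y i} =
    (if twisted p x = {} then if twisted p y = {} then n else 0
     else if twisted p y = {} \<or> twisted p y = twisted p x then n div 2 else 0)"
    (is "card ?S = _")
proof -
  define A where "A = {a \<in> {0..<int n}. twisted p y = (if even a then {} else twisted p x)}"
  have y1: "y 1 \<in> {0..<int n}"
    using xy(2) p unfolding half_turn_def by (auto simp: PiE_def Pi_iff)
  have "?S = (\<lambda>a. (a, (y 1 - a * x 1) mod int n)) ` A"
  proof (intro equalityI subsetI)
    fix s assume "s \<in> ?S"
    then obtain a b where s: "s = (a, b)" "a \<in> {0..<int n}" "b \<in> {0..<int n}"
      and ab: "(a * x 1 + b) mod int n = y 1" "twisted p y = (if even a then {} else twisted p x)"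
      using affine_half_turn_iff[OF n p xy] by auto
    have "(y 1 - a * x 1) mod int n = b"
      using s(3) unfolding ab(1)[symmetric] by (simp add: mod_simps)
    then show "s \<in> (\<lambda>a. (a, (y 1 - a * x 1) mod int n)) ` A"
      using s ab by (auto simp: A_def)
  next
    fix s assume "s \<in> (\<lambda>a. (a, (y 1 - a * x 1) mod int n)) ` A"
    then obtain a where a: "a \<in> A" "s = (a, (y 1 - a * x 1) mod int n)" by auto
    have "(a * x 1 + (y 1 - a * x 1) mod int n) mod int n = y 1"
      using y1 by (simp add: mod_simps)
    then show "s \<in> ?S"
      using a n affine_half_turn_iff[OF n p xy] by (simp add: A_def)
  qed
  then have "card ?S = card A" by (simp add: card_image inj_on_def)
  moreover have "card A = card ((if twisted p y = {} then {a \<in> {0..<int n}. even a} else {}) \<union>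
      (if twisted p y = twisted p x then {a \<in> {0..<int n}. odd a} else {}))"
    unfolding A_def by (rule arg_cong[of _ _ card]) auto
  moreover have "{a \<in> {0..<int n}. even a} \<union> {a \<in> {0..<int n}. odd a} = {0..<int n}" by auto
  ultimately show ?thesis
    using card_even_below[OF n(1)] card_odd_below[OF n(1)] by auto
qed

section \<open>The coloring quiver\<close>

lemma quandle_hom_compose:
  assumes "is_quandle X" "f \<in> quandle_hom X Y" "g \<in> quandle_hom Y Z"
  shows "compose (qcarrier X) g f \<in> quandle_hom X Z"
  using assms unfolding quandle_hom_def is_quandle_def
  by (auto simp: compose_def PiE_iff)

section \<open>The target graph and its edge multiplicities\<close>

definition quiver_model ::
  "nat \<Rightarrow> nat \<Rightarrow> nat \<Rightarrow> nat \<Rightarrow>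
    (nat + nat \<times> nat, (nat \<times> nat \<times> nat + nat \<times> nat \<times> nat \<times> nat) + (nat \<times> nat) \<times> nat \<times> nat) pre_digraph" where
  "quiver_model m \<omega> N d =
     directed_join d (complete_multidigraph m \<omega>) (copies N (complete_multidigraph m d))"

lemmas quiver_model_defs = quiver_model_def directed_join_def complete_multidigraph_def copies_def

lemma verts_quiver_model: "verts (quiver_model m \<omega> N d) = {..<m} <+> {..<N} \<times> {..<m}"
  by (simp add: quiver_model_defs)

lemma wf_quiver_model: "wf_digraph (quiver_model m \<omega> N d)"
  by unfold_locales (auto simp: quiver_model_defs)

lemma finite_arcs_quiver_model: "finite (arcs (quiver_model m \<omega> N d))"
  by (auto simp: quiver_model_defs)

text \<open>\<open>Inl\<close> marks the component that receives the joining edges; the first entry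
  under \<open>Inr\<close> is the number of the copy.\<close>

fun quiver_model_mult :: "nat \<Rightarrow> nat \<Rightarrow> nat + nat \<times> nat \<Rightarrow> nat + nat \<times> nat \<Rightarrow> nat" where
  "quiver_model_mult \<omega> d (Inl i) (Inl j) = \<omega>"
| "quiver_model_mult \<omega> d (Inl i) (Inr t) = 0"
| "quiver_model_mult \<omega> d (Inr s) (Inl j) = d"
| "quiver_model_mult \<omega> d (Inr s) (Inr t) = (if fst s = fst t then d else 0)"

lemma card_quiver_model_between:
  assumes "u \<in> verts (quiver_model m \<omega> N d)" "v \<in> verts (quiver_model m \<omega> N d)"
  shows "card {a \<in> arcs (quiver_model m \<omega> N d).
      tail (quiver_model m \<omega> N d) a = u \<and> head (quiver_model m \<omega> N d) a = v} =
    quiver_model_mult \<omega> d u v" (is "card ?S = _")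
proof -
  consider (11) i j where "u = Inl i" "v = Inl j" "i < m" "j < m"
    | (12) i t where "u = Inl i" "v = Inr t"
    | (21) b i j where "u = Inr (b, i)" "v = Inl j" "b < N" "i < m" "j < m"
    | (22) b i c j where "u = Inr (b, i)" "v = Inr (c, j)" "b < N" "i < m" "c < N" "j < m"
    using assms by (cases u; cases v) (auto simp: verts_quiver_model)
  then show ?thesis
  proof cases
    case 11
    then have "?S = (\<lambda>k. Inl (Inl (i, j, k))) ` {..<\<omega>}" by (auto simp: quiver_model_defs)
    then show ?thesis using 11 by (simp add: card_image inj_on_def)
  next
    case 12
    then have "?S = {}" by (auto simp: quiver_model_defs)
    then show ?thesis using 12 by (simp only: card.empty quiver_model_mult.simps)
  next
    case 21
    then have "?S = (\<lambda>k. Inr ((b, i), j, k)) ` {..<d}" by (auto simp: quiver_model_defs)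
    then show ?thesis using 21 by (simp add: card_image inj_on_def)
  next
    case 22
    then have "?S = (if b = c then (\<lambda>k. Inl (Inr (b, i, j, k))) ` {..<d} else {})"
      by (auto simp: quiver_model_defs)
    then show ?thesis using 22 by (simp add: card_image inj_on_def)
  qed
qed

section \<open>Edge multiplicities of the coloring quiver\<close>

lemma wf_full_coloring_quiver: "wf_digraph (full_coloring_quiver X D)"
  by unfold_locales
     (auto simp: full_coloring_quiver_def intro: quandle_hom_compose is_quandle_fundamental_quandle)

text \<open>Rows determine homomorphisms, so an edge from \<open>f\<close> to \<open>g\<close> is an
  endomorphism carrying the row of \<open>f\<close> to that of \<open>g\<close>. By
  \<open>inj_on_affine\<close> these endomorphisms correspond to pairs
  \<open>(a, b)\<close>.\<close>

lemma card_colorings_between: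
  assumes n: "even n" "n > 0" and p: "p > 0"
    and w: "\<And>l. l \<in> set w \<Longrightarrow> 1 \<le> snd l \<and> snd l < p"
    and fg: "f \<in> quandle_hom (fundamental_quandle (braid_closure p w)) (dihedral_quandle n)"
      "g \<in> quandle_hom (fundamental_quandle (braid_closure p w)) (dihedral_quandle n)"
    and half: "half_turn n p (strand_colors p w f)" "half_turn n p (strand_colors p w g)"
  shows "card {a \<in> arcs (full_coloring_quiver (dihedral_quandle n) (braid_closure p w)).
      tail (full_coloring_quiver (dihedral_quandle n) (braid_closure p w)) a = f \<and>
      head (full_coloring_quiver (dihedral_quandle n) (braid_closure p w)) a = g} =
    (if twisted p (strand_colors p w f) = {}
     then if twisted p (strand_colors p w g) = {} then n else 0
     else if twisted p (strand_colors p w g) = {} \<or>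
       twisted p (strand_colors p w g) = twisted p (strand_colors p w f) then n div 2 else 0)"
    (is "card ?S = ?r")
proof -
  let ?Q = "fundamental_quandle (braid_closure p w)" and ?R = "dihedral_quandle n"
  let ?x = "strand_colors p w f" and ?y = "strand_colors p w g"
  let ?A = "\<lambda>(a, b). \<lambda>x\<in>{0..<int n}. (a * x + b) mod int n"
  let ?T = "{(a, b) \<in> {0..<int n} \<times> {0..<int n}. \<forall>i\<in>{1..p}. (a * ?x i + b) mod int n = ?y i}"
  have range: "?x i \<in> {0..<int n}" if "i \<in> {1..p}" for i
    using half(1) that unfolding half_turn_def by blast
  have comp: "compose (qcarrier ?Q) \<phi> f = g \<longleftrightarrow> (\<forall>i\<in>{1..p}. \<phi> (?x i) = ?y i)"
    if \<phi>: "\<phi> \<in> quandle_hom ?R ?R" for \<phi>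
  proof -
    have "compose (qcarrier ?Q) \<phi> f \<in> quandle_hom ?Q ?R"
      by (rule quandle_hom_compose[OF is_quandle_fundamental_quandle fg(1) \<phi>])
    then have "compose (qcarrier ?Q) \<phi> f = g \<longleftrightarrow>
        strand_colors p w (compose (qcarrier ?Q) \<phi> f) = ?y"
      using bij_betw_strand_colors[OF n(2) w] fg(2) by (auto simp: bij_betw_def dest: inj_onD)
    also have "\<dots> \<longleftrightarrow> compose {1..p} \<phi> ?x = ?y"
      unfolding strand_colors_compose[OF fg(1)] ..
    also have "\<dots> \<longleftrightarrow> (\<forall>i\<in>{1..p}. \<phi> (?x i) = ?y i)"
      by (auto simp: compose_def fun_eq_iff strand_colors_def)
    finally show ?thesis .
  qed
  have "?S = Pair f ` {\<phi> \<in> quandle_hom ?R ?R. compose (qcarrier ?Q) \<phi> f = g}"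
    using fg(1) by (auto simp: full_coloring_quiver_def)
  also have "{\<phi> \<in> quandle_hom ?R ?R. compose (qcarrier ?Q) \<phi> f = g} =
      {\<phi> \<in> quandle_hom ?R ?R. \<forall>i\<in>{1..p}. \<phi> (?x i) = ?y i}"
    using comp by blast
  also have "{\<phi> \<in> quandle_hom ?R ?R. \<forall>i\<in>{1..p}. \<phi> (?x i) = ?y i} = ?A ` ?T"
    unfolding quandle_hom_dihedral_eq[OF n(2)] using range by (force simp del: atLeastAtMost_iff atLeastLessThan_iff)
  finally have "card ?S = card (?A ` ?T)" by (simp add: card_image inj_on_def)
  also have "\<dots> = card ?T"
  proof (rule card_image)
    have "n \<ge> 2" using n by (auto elim!: evenE)
    then show "inj_on ?A ?T" by (rule inj_on_subset[OF inj_on_affine]) auto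
  qed
  also have "\<dots> = ?r" by (rule card_affine_maps_between[OF n p half])
  finally show ?thesis .
qed

theorem theorem4p3:
  fixes p q n :: nat
  assumes "prime p" and "q > 0" and "n > 0" and "even n"
    and "card (quandle_hom (fundamental_quandle (torus_link p q)) (dihedral_quandle n))
           = 2 ^ (p - 1) * n"
  shows "digraph_iso (full_coloring_quiver (dihedral_quandle n) (torus_link p q))
           (directed_join (n div 2)
              (complete_multidigraph n n)
              (copies (2 ^ (p - 1) - 1) (complete_multidigraph n (n div 2))))"
proof -
  note n = assms(4,3)
  have p: "p > 0" using prime_gt_0_nat[OF assms(1)] .
  let ?w = "torus_word p q" and ?N = "2 ^ (p - 1) - 1 :: nat"
  let ?G = "full_coloring_quiver (dihedral_quandle n) (torus_link p q)"
    and ?M = "quiver_model n n ?N (n div 2)"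
  let ?H = "quandle_hom (fundamental_quandle (torus_link p q)) (dihedral_quandle n)"
    and ?F = "braid_fixed n p ?w" and ?E = "Pow {2..p} - {{}}"
  have letters: "\<And>l. l \<in> set ?w \<Longrightarrow> 1 \<le> snd l \<and> snd l < p" using torus_word_letters .
  have col: "bij_betw (strand_colors p ?w) ?H ?F"
    unfolding torus_link_eq by (rule bij_betw_strand_colors[OF n(2) letters])
  have cardF: "card ?F = 2 ^ (p - 1) * n" using bij_betw_same_card[OF col] assms(5) by simp
  have half: "half_turn n p x" if "x \<in> ?F" for x
    using torus_fixed_half_turn[OF assms(1) n(2) cardF that] that
    by (auto simp: half_turn_def braid_fixed_def)
  \<comment> \<open>Strand 1 never deviates from itself, so the second coordinate ranges over
    subsets of \<open>{2..p}\<close>.\<close>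
  define key where "key x = (nat (x 1), twisted p x)" for x :: "nat \<Rightarrow> int"
  have first: "x 1 \<in> {0..<int n}" if "x \<in> ?F" for x
    using half[OF that] p unfolding half_turn_def by (auto simp: PiE_def Pi_iff)
  have key: "bij_betw key ?F ({..<n} \<times> Pow {2..p})"
  proof -
    have inj: "inj_on key ?F"
    proof (rule inj_onI)
      fix x y assume xy: "x \<in> ?F" "y \<in> ?F" "key x = key y"
      then have "x 1 = y 1" "twisted p x = twisted p y"
        using first[OF xy(1)] first[OF xy(2)] by (auto simp: key_def)
      then show "x = y" using half_turn_eqI[OF n p half[OF xy(1)] half[OF xy(2)]] by blast
    qed
    have "key ` ?F \<subseteq> {..<n} \<times> Pow {2..p}"
    proof (rule image_subsetI)
      fix x assume x: "x \<in> ?F"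
      have "i \<ge> 2" if "i \<in> twisted p x" for i
      proof -
        have "i \<noteq> 1" "i \<ge> 1" using that by (auto simp: twisted_def)
        then show ?thesis by simp
      qed
      then show "key x \<in> {..<n} \<times> Pow {2..p}"
        using first[OF x] by (auto simp: key_def twisted_def)
    qed
    \<comment> \<open>The assumed number of colorings is the size of the target, so the injective
      \<open>key\<close> hits every pair.\<close>
    moreover have "card (key ` ?F) = card ({..<n} \<times> Pow {2..p})"
      using cardF card_image[OF inj] by (simp add: card_cartesian_product card_Pow)
    ultimately have "key ` ?F = {..<n} \<times> Pow {2..p}"
      by (intro card_subset_eq) auto
    with inj show ?thesis by (simp add: bij_betw_def)
  qed
  have "card ?E = card {..<?N}" by (simp add: card_Diff_singleton card_Pow)
  \<comment> \<open>\<open>e\<close> numbers the nonempty sets of deviating strands; each of them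
    becomes one copy.\<close>
  then obtain e where e: "bij_betw e ?E {..<?N}"
    using finite_same_card_bij[of ?E "{..<?N}"] by auto
  \<comment> \<open>Constant colorings form the receiving component, and deviating set
    \<open>T\<close> selects copy \<open>e T\<close>; the first color is the vertex number in both
    cases.\<close>
  define place where "place = (\<lambda>(c, T). if T = {} then Inl c else Inr (e T, c :: nat))"
  have place: "bij_betw place ({..<n} \<times> Pow {2..p}) (verts ?M)"
    unfolding verts_quiver_model
  proof (rule bij_betw_imageI)
    show "inj_on place ({..<n} \<times> Pow {2..p})"
      using e by (auto simp: place_def bij_betw_def inj_on_def split: if_splits)
    show "place ` ({..<n} \<times> Pow {2..p}) = {..<n} <+> {..<?N} \<times> {..<n}"
    proof (intro equalityI image_subsetI subsetI)
      fix k assume "k \<in> {..<n} \<times> Pow {2..p}"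
      then show "place k \<in> {..<n} <+> {..<?N} \<times> {..<n}"
        using bij_betwE[OF e] by (auto simp: place_def)
    next
      fix v assume "v \<in> {..<n} <+> {..<?N} \<times> {..<n}"
      then consider c where "v = Inl c" "c < n" | b c where "v = Inr (b, c)" "b \<in> {..<?N}" "c < n" by auto
      then show "v \<in> place ` ({..<n} \<times> Pow {2..p})"
      proof cases
        case 1
        then show ?thesis by (intro image_eqI[of _ _ "(c, {})"]) (auto simp: place_def)
      next
        case 2
        then obtain T where "T \<in> ?E" "b = e T" using e by (auto simp: bij_betw_def)
        then show ?thesis using 2 by (intro image_eqI[of _ _ "(c, T)"]) (auto simp: place_def)
      qed
    qed
  qed
  let ?V = "place \<circ> (key \<circ> strand_colors p ?w)"
  have V: "bij_betw ?V (verts ?G) (verts ?M)"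
    using bij_betw_trans[OF bij_betw_trans[OF col key] place]
    by (simp add: full_coloring_quiver_def comp_assoc)
  have finH: "finite ?H"
    using bij_betw_finite[OF col] finite_braid_fixed by blast
  have "digraph_iso ?G ?M"
  proof (rule digraph_iso_of_multiplicities[OF wf_full_coloring_quiver wf_quiver_model _
        finite_arcs_quiver_model V])
    show "finite (arcs ?G)"
      using finH by (simp add: full_coloring_quiver_def quandle_hom_dihedral_eq[OF n(2)])
  next
    fix f g assume "f \<in> verts ?G" "g \<in> verts ?G"
    then have fg: "f \<in> ?H" "g \<in> ?H" by (simp_all add: full_coloring_quiver_def)
    define x y where "x = strand_colors p ?w f" and "y = strand_colors p ?w g"
    have xy: "x \<in> ?F" "y \<in> ?F" using fg bij_betwE[OF col] by (auto simp: x_def y_def)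
    then have T: "twisted p x \<in> Pow {2..p}" "twisted p y \<in> Pow {2..p}"
      using bij_betwE[OF key] by (auto simp: key_def)
    have "card {a \<in> arcs ?G. tail ?G a = f \<and> head ?G a = g} =
      (if twisted p x = {} then if twisted p y = {} then n else 0
       else if twisted p y = {} \<or> twisted p y = twisted p x then n div 2 else 0)"
      using card_colorings_between[OF n p letters] fg half[OF xy(1)] half[OF xy(2)]
      unfolding torus_link_eq x_def y_def by blast
    also have "\<dots> = quiver_model_mult n (n div 2) (?V f) (?V g)"
    proof -
      \<comment> \<open>Two nonconstant colorings share a copy exactly when their deviating sets
        agree.\<close>
      have "e (twisted p x) = e (twisted p y) \<longleftrightarrow> twisted p x = twisted p y"
        if "twisted p x \<noteq> {}" "twisted p y \<noteq> {}"
        using e T that by (auto simp: bij_betw_def dest!: inj_onD)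
      then show ?thesis by (auto simp: place_def key_def simp flip: x_def y_def)
    qed
    also have "\<dots> = card {a \<in> arcs ?M. tail ?M a = ?V f \<and> head ?M a = ?V g}"
      by (rule card_quiver_model_between[symmetric])
         (use bij_betwE[OF V] \<open>f \<in> verts ?G\<close> \<open>g \<in> verts ?G\<close> in blast)+
    finally show "card {a \<in> arcs ?G. tail ?G a = f \<and> head ?G a = g} =
      card {a \<in> arcs ?M. tail ?M a = ?V f \<and> head ?M a = ?V g}" .
  qed
  then show ?thesis by (simp only: quiver_model_def)
qed

end
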